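(* Let the data $X,K,X_j,\gamma_j,A,Y,\varphi,j,f,R,q,a_S$ satisfy the standing assumptions listed in the context, and let $j_c:X_j\to X_j^*$ be a linear operator such that $\|j_c(z)\|_{X_j^*}\le\alpha_c\|z\|_{X_j}$ and $\langle j_c(z),z\rangle_{X_j}\ge\alpha_j\|z\|_{X_j}^2$ for all $z\in X_j$. Assume $$\alpha_\varphi+\alpha_jc_j^2<m_A,\qquad \alpha_\varphi+\alpha_cc_j^2<m_A/3,$$ $q\in C^2(\mathbb R_+\times\mathbb R_+;\mathcal L(X))$, and that the solution $u\in C(\mathbb R_+;K)$ of the continuous problem stated in the context satisfies $u\in W^{2,\infty}_{loc}(\mathbb R_+;X)$. Fix $T>0$. For a positive integer $N$, $k=T/N$, and a mesh parameter $h$, let $u^{kh}=\{u_n^{kh}\}_{n=0}^N\subset K^h$ be such that for every $2\le n\le N$ and every $v^h\in K^h$, $$\langle Au_n^{kh},v^h-u_n^{kh}\rangle+\varphi(\mathcal S_{n,L}^ku^{kh},2u_{n-1}^{kh}-u_{n-2}^{kh},v^h)-\varphi(\mathcal S_{n,L}^ku^{kh},2u_{n-1}^{kh}-u_{n-2}^{kh},u_n^{kh})+j^0(\gamma_ju_n^{kh};\gamma_jv^h-\gamma_ju_n^{kh})$$ $$+\langle j_c(\gamma_ju_n^{kh}),\gamma_jv^h-\gamma_ju_n^{kh}\rangle_{X_j}\ge\langle f_n,v^h-u_n^{kh}\rangle+\langle j_c(2\gamma_ju_{n-1}^{kh}-\gamma_ju_{n-2}^{kh}),\gamma_jv^h-\gamma_ju_n^{kh}\rangle_{X_j},$$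 and for $n=0,1$ and every $v^h\in K^h$, $$\langle Au_n^{kh},v^h-u_n^{kh}\rangle+\varphi(\mathcal S_{n,L}^ku^{kh},u_n^{kh},v^h)-\varphi(\mathcal S_{n,L}^ku^{kh},u_n^{kh},u_n^{kh})+j^0(\gamma_ju_n^{kh};\gamma_jv^h-\gamma_ju_n^{kh})\ge\langle f_n,v^h-u_n^{kh}\rangle.$$ Then there is a constant $C_6>0$ independent of $k$ and $h$ such that, with $u_n=u(t_n)$, $$\max_{0\le n\le N}\|u_n-u_n^{kh}\|_X\le C_6\max_{0\le n\le N}\inf_{v^h\in K^h}\left\{\|u_n-v^h\|_X+\|\gamma_ju_n-\gamma_jv^h\|_{X_j}^{1/2}+|E(v^h,u_n)|^{1/2}\right\}+C_6k^2,$$ where, for $v^h\in K^h$ and with $\mathcal S_nu=(\mathcal Su)(t_n)$, $$E(v^h,u_n)=\langle Au_n,v^h-u_n\rangle+\varphi(\mathcal S_nu,u_n,v^h)-\varphi(\mathcal S_nu,u_n,u_n)+j^0(\gamma_ju_n;\gamma_jv^h-\gamma_ju_n)-\langle f_n,v^h-u_n\rangle.$$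
   Context: Notation. All spaces are real. $\mathbb R_+=[0,\infty)$; $X^*,X_j^*$ are topological duals; $\langle\cdot,\cdot\rangle$ is the duality pairing between $X^*$ and $X$, $\langle\cdot,\cdot\rangle_{X_j}$ the one between $X_j^*$ and $X_j$; $\mathcal L(\cdot;\cdot)$ denotes bounded linear operators, $\mathcal L(X)=\mathcal L(X;X)$. For a locally Lipschitz $j:X_j\to\mathbb R$, the Clarke directional derivative is $j^0(x;v)=\limsup_{y\to x,\lambda\downarrow0}\frac{j(y+\lambda v)-j(y)}{\lambda}$ and $\partial j(x)=\{\xi\in X_j^*: j^0(x;v)\ge\langle\xi,v\rangle_{X_j}\ \forall v\in X_j\}$. Standing assumptions on the data. $X$ is a reflexive Banach space, $K\subset X$ is closed and convex, $0\in K$. $X_j$ is a Banach space, $\gamma_j\in\mathcal L(X;X_j)$ and $c_j>0$ satisfies $\|\gamma_jv\|_{X_j}\le c_j\|v\|_X$ for all $v\in X$. $A:X\to X^*$ is Lipschitz continuous with constant $L_A>0$ and strongly monotone: $\langle Av_1-Av_2,v_1-v_2\rangle\ge m_A\|v_1-v_2\|_X^2$ for all $v_1,v_2\in X$, with $m_A>0$. $Y$ is a normed space and $\varphi:Y\times K\times K\to\mathbb R$ is such that $\varphi(y,u,\cdot)$ is convex and lower semicontinuous on $K$ for all $y\in Y,u\in K$, and there are $\alpha_\varphi>0,\beta_\varphi>0$ with $\varphi(y_1,u_1,v_2)-\varphi(y_1,u_1,v_1)+\varphi(y_2,u_2,v_1)-\varphi(y_2,u_2,v_2)\le\alpha_\varphi\|u_1-u_2\|_X\|v_1-v_2\|_X+\beta_\varphi\|y_1-y_2\|_Y\|v_1-v_2\|_X$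 for all $y_1,y_2\in Y$, $u_1,u_2,v_1,v_2\in K$. The function $j:X_j\to\mathbb R$ is locally Lipschitz; there are $c_0,c_1\ge0$ with $\|\xi\|_{X_j^*}\le c_0+c_1\|z\|_{X_j}$ for all $z\in X_j$, $\xi\in\partial j(z)$; there is $\alpha_j>0$ with $j^0(z_1;z_2-z_1)+j^0(z_2;z_1-z_2)\le\alpha_j\|z_1-z_2\|_{X_j}^2$ for all $z_1,z_2\in X_j$. $f\in C(\mathbb R_+;X^* )$. $R\in\mathcal L(X;Y)$, $q\in C(\mathbb R_+\times\mathbb R_+;\mathcal L(X))$, $a_S\in X$; these define the history-dependent operator $(\mathcal Sv)(t)=R\left(\int_0^tq(t,s)v(s)\,ds+a_S\right)$ for $v\in C(\mathbb R_+;X)$. Continuous problem. Find $u\in C(\mathbb R_+;K)$ such that for all $t\in\mathbb R_+$ and all $v\in K$, $\langle Au(t),v-u(t)\rangle+\varphi((\mathcal Su)(t),u(t),v)-\varphi((\mathcal Su)(t),u(t),u(t))+j^0(\gamma_ju(t);\gamma_jv-\gamma_ju(t))\ge\langle f(t),v-u(t)\rangle$. Discretization. $t_n=nk$, $0\le n\le N$, $f_n=f(t_n)$. For a sequence $v=\{v_n\}$ in $X$ and $n\ge1$, $\mathcal S_{n,L}^kv=R\left(\frac k2q(t_n,t_0)v_0+k\sum_{i=1}^{n-1}q(t_n,t_i)v_i+\frac k2q(t_n,t_{n-1})v_{n-1}+a_S\right)$ (empty sum $=0$), and $\mathcal S_{0,L}^kv=R\,a_S$. For each $h$, $X^h\subset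 X$ is a (finite-dimensional, conforming) finite element space associated with a mesh of size $h$ from a regular family of partitions, and $K^h=X^h\cap K$, which is nonempty, convex and closed.
   Formalization: Since φ is given only on Y×K×K, 2u_{n-1}^{kh}-u_{n-2}^{kh} may leave its domain; it is assumed to lie in a set D⊇K, and the hypotheses on φ hold for second arguments in D (D=K or D=X allowed). Also α_c≥0 is assumed, automatic unless X_j={0}. *)

theory Defs
  imports "HOL-Analysis.Analysis"
begin

text \<open>The topological dual of a real normed space \<open>'a\<close> is \<open>'a \<Rightarrow>\<^sub>L real\<close> with the operator norm;
  the duality pairing is application.\<close>

definition reflexive_space :: "'a::real_normed_vector itself \<Rightarrow> bool" where
  "reflexive_space _ \<longleftrightarrow>
     (\<forall>F :: ('a \<Rightarrow>\<^sub>L real) \<Rightarrow>\<^sub>L real. \<exists>x::'a. \<forall>l. blinfun_apply F l = blinfun_apply l x)"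

definition lsc_on :: "'a::topological_space set \<Rightarrow> ('a \<Rightarrow> real) \<Rightarrow> bool" where
  "lsc_on S g \<longleftrightarrow> (\<forall>x\<in>S. \<forall>a<g x. \<forall>\<^sub>F y in at x within S. a < g y)"

definition loc_lipschitz :: "('a::metric_space \<Rightarrow> real) \<Rightarrow> bool" where
  "loc_lipschitz j \<longleftrightarrow> (\<forall>x. \<exists>e>0. \<exists>L. L-lipschitz_on (ball x e) j)"

text \<open>The base point \<open>y\<close> may equal \<open>x\<close>, hence the filter \<open>nhds x\<close>. The upper limit is taken in the
  extended reals; it is finite whenever \<open>j\<close> is locally Lipschitz.\<close>

definition clarke_deriv :: "('a::real_normed_vector \<Rightarrow> real) \<Rightarrow> 'a \<Rightarrow> 'a \<Rightarrow> real" where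
  "clarke_deriv j x v = real_of_ereal
     (Limsup (nhds x \<times>\<^sub>F at_right 0) (\<lambda>(y, l). ereal ((j (y + l *\<^sub>R v) - j y) / l)))"

definition clarke_subdiff :: "('a::real_normed_vector \<Rightarrow> real) \<Rightarrow> 'a \<Rightarrow> ('a \<Rightarrow>\<^sub>L real) set" where
  "clarke_subdiff j x = {\<xi>. \<forall>v. clarke_deriv j x v \<ge> blinfun_apply \<xi> v}"

text \<open>Derivatives are taken relative to \<open>S\<close>, i.e. up to the boundary for \<open>S = {0..} \<times> {0..}\<close>.\<close>

definition C2_on :: "'a::real_normed_vector set \<Rightarrow> ('a \<Rightarrow> 'b::real_normed_vector) \<Rightarrow> bool" where
  "C2_on S g \<longleftrightarrow> (\<exists>(g' :: 'a \<Rightarrow> 'a \<Rightarrow>\<^sub>L 'b) (g'' :: 'a \<Rightarrow> 'a \<Rightarrow>\<^sub>L 'a \<Rightarrow>\<^sub>L 'b).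
     (\<forall>p\<in>S. (g has_derivative blinfun_apply (g' p)) (at p within S)) \<and>
     (\<forall>p\<in>S. (g' has_derivative blinfun_apply (g'' p)) (at p within S)) \<and>
     continuous_on S g'')"

text \<open>The space \<open>L\<^sup>\<infinity>\<^sub>l\<^sub>o\<^sub>c(\<real>\<^sub>+; X)\<close> of strongly (Bochner) measurable functions that are essentially
  bounded on each bounded interval. The codomain need not be separable, so strong measurability is
  spelled out as almost everywhere approximability by simple functions.\<close>

definition Linf_loc :: "(real \<Rightarrow> 'a::real_normed_vector) \<Rightarrow> bool" where
  "Linf_loc g \<longleftrightarrow>
     (\<exists>s :: nat \<Rightarrow> real \<Rightarrow> 'a. (\<forall>n. simple_function lebesgue (s n)) \<and>
        (AE t in lebesgue. 0 < t \<longrightarrow> (\<lambda>n. s n t) \<longlonglongrightarrow> g t)) \<and>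
     (\<forall>T>0. \<exists>M. AE t in lebesgue. 0 < t \<and> t < T \<longrightarrow> norm (g t) \<le> M)"

text \<open>Test functions in \<open>C\<^sub>c\<^sup>1(0, \<infinity>)\<close>, together with their derivative.\<close>

definition test_fun :: "(real \<Rightarrow> real) \<Rightarrow> (real \<Rightarrow> real) \<Rightarrow> bool" where
  "test_fun \<psi> \<psi>' \<longleftrightarrow>
     (\<forall>t. (\<psi> has_real_derivative \<psi>' t) (at t)) \<and> continuous_on UNIV \<psi>' \<and>
     (\<exists>a b. 0 < a \<and> a \<le> b \<and> (\<forall>t. t \<notin> {a..b} \<longrightarrow> \<psi> t = 0))"

text \<open>\<open>g\<close> is the weak derivative of \<open>w\<close> on \<open>(0, \<infinity>)\<close>: \<open>\<integral> \<psi>' w = - \<integral> \<psi> g\<close> for all test functions.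
  For functions in \<open>Linf_loc\<close> the integrands are Bochner integrable, and the gauge integral used here
  (which does not need a separable codomain) agrees with the Bochner integral.\<close>

definition weak_deriv :: "(real \<Rightarrow> 'a::real_normed_vector) \<Rightarrow> (real \<Rightarrow> 'a) \<Rightarrow> bool" where
  "weak_deriv w g \<longleftrightarrow> (\<forall>\<psi> \<psi>'. test_fun \<psi> \<psi>' \<longrightarrow>
     (\<exists>I. ((\<lambda>t. \<psi>' t *\<^sub>R w t) has_integral I) {0<..} \<and>
          ((\<lambda>t. \<psi> t *\<^sub>R g t) has_integral - I) {0<..}))"

definition W2inf_loc :: "(real \<Rightarrow> 'a::real_normed_vector) \<Rightarrow> bool" where
  "W2inf_loc u \<longleftrightarrow> (\<exists>u' u''. Linf_loc u \<and> Linf_loc u' \<and> Linf_loc u'' \<and>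
     weak_deriv u u' \<and> weak_deriv u' u'')"

definition hist_op :: "('x::banach \<Rightarrow>\<^sub>L 'y::real_normed_vector) \<Rightarrow> (real \<times> real \<Rightarrow> 'x \<Rightarrow>\<^sub>L 'x) \<Rightarrow> 'x \<Rightarrow>
    (real \<Rightarrow> 'x) \<Rightarrow> real \<Rightarrow> 'y" where
  "hist_op R q a v t = R (integral {0..t} (\<lambda>s. q (t, s) (v s)) + a)"

definition disc_hist_op :: "('x::banach \<Rightarrow>\<^sub>L 'y::real_normed_vector) \<Rightarrow> (real \<times> real \<Rightarrow> 'x \<Rightarrow>\<^sub>L 'x) \<Rightarrow> 'x \<Rightarrow>
    real \<Rightarrow> (nat \<Rightarrow> 'x) \<Rightarrow> nat \<Rightarrow> 'y" where
  "disc_hist_op R q a k v n =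
     (let t = (\<lambda>i. real i * k) in
      if n = 0 then R a
      else R ((k / 2) *\<^sub>R q (t n, t 0) (v 0)
              + k *\<^sub>R (\<Sum>i = 1..<n. q (t n, t i) (v i))
              + (k / 2) *\<^sub>R q (t n, t (n - 1)) (v (n - 1)) + a))"

text \<open>The residual \<open>E(v, w)\<close> of the variational-hemivariational inequality with history value \<open>y\<close>
  and load \<open>l\<close>, at the point \<open>w\<close>.\<close>

definition vhi_residual :: "('x::banach \<Rightarrow> 'x \<Rightarrow>\<^sub>L real) \<Rightarrow> ('y \<Rightarrow> 'x \<Rightarrow> 'x \<Rightarrow> real) \<Rightarrow>
    ('z::banach \<Rightarrow> real) \<Rightarrow> ('x \<Rightarrow>\<^sub>L 'z) \<Rightarrow> 'y \<Rightarrow> ('x \<Rightarrow>\<^sub>L real) \<Rightarrow> 'x \<Rightarrow> 'x \<Rightarrow> real" where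
  "vhi_residual A \<phi> j \<gamma> y l v w =
     A w (v - w) + \<phi> y w v - \<phi> y w w + clarke_deriv j (\<gamma> w) (\<gamma> v - \<gamma> w) - l (v - w)"

end

theory Submission
  imports Defs
begin

text \<open>
The proof compares, at each time level, the exact solution \<open>u\<close> with the discrete solution \<open>w\<close> through
strong monotonicity of \<open>A\<close>. Testing the continuous inequality with \<open>w\<close> and the discrete one with an
arbitrary \<open>v\<close> from the discrete set yields an energy inequality
(\<open>vhi_energy_inequality\<close>) whose right-hand side consists of the residual and the approximation errors of
\<open>v\<close>, a history error, and an extrapolation error. In the extrapolated steps the
nonconvexity of \<open>j\<close> is compensated by the coercivity of \<open>j\<^sub>c\<close>
(\<open>extrapolated_stabilization_bound\<close>). What is left over is the extrapolation error
\<open>u\<^sub>n - 2 w\<^sub>n\<^sub>-\<^sub>1 + w\<^sub>n\<^sub>-\<^sub>2\<close> with factor \<open>(\<alpha>\<^sub>\<phi> + \<alpha>\<^sub>c c\<^sub>j\<^sup>2) / m\<^sub>A < 1 / 3\<close>. It is bounded by three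
times the largest earlier error and a second difference of \<open>u\<close>, so the
error recursion is a contraction up to a history sum of size \<open>k (e\<^sub>0 + \<dots> + e\<^sub>n\<^sub>-\<^sub>1)\<close>. A discrete Gronwall
inequality (\<open>discrete_gronwall_contraction\<close>) closes the estimate. Only after the square
root has been taken is the infimum over \<open>v\<close> formed, separately at every time level.

Three ingredients are needed besides.

The order \<open>k\<^sup>2\<close> comes from bounds on second differences. They are obtained from the weak
derivatives by testing with cubic splines whose second derivative is a second difference of narrow
hats (\<open>weak_deriv2_second_difference\<close>); continuity of \<open>u\<close> lets the width of the hats tend to 0. Such bounds
pass to products with the kernel \<open>q\<close>.

The same bounds control the quadrature of the history (\<open>history_operator_error\<close>): the rule is a composite
trapezoidal rule with one left rectangle on the last step, and its error is estimated by pairing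
points symmetric about the midpoint.

Finally, bounding Clarke derivatives by the growth of subgradients requires that the Clarke
derivative is the maximum of the subgradients (\<open>clarke_deriv_growth\<close>). This is an instance of the
Hahn-Banach theorem, which is proved here by showing that minimal sublinear functionals are linear.
\<close>

section \<open>Linear minorants of sublinear functionals\<close>

text \<open>Only an inequality is demanded in the homogeneity clause; equality is a consequence, and the clause
for the factor 0 also forces \<open>p 0 = 0\<close>. This weak form is what infima of functionals inherit directly.\<close>

definition sublinear :: "('a::real_vector \<Rightarrow> real) \<Rightarrow> bool" where
  "sublinear p \<longleftrightarrow> (\<forall>x y. p (x + y) \<le> p x + p y) \<and> (\<forall>c\<ge>0. \<forall>x. p (c *\<^sub>R x) \<le> c * p x)"

lemma sublinear_add: "sublinear p \<Longrightarrow> p (x + y) \<le> p x + p y"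
  and sublinear_scale_le: "sublinear p \<Longrightarrow> c \<ge> 0 \<Longrightarrow> p (c *\<^sub>R x) \<le> c * p x"
  by (auto simp: sublinear_def)

lemma sublinear_zero: "sublinear p \<Longrightarrow> p 0 = 0"
  using sublinear_add[of p 0 0] sublinear_scale_le[of p 0 0] by simp

lemma sublinear_scale:
  assumes "sublinear p" "c \<ge> 0"
  shows "p (c *\<^sub>R x) = c * p x"
proof (cases "c = 0")
  case True
  then show ?thesis using sublinear_zero[OF assms(1)] by simp
next
  case False
  with assms have c: "c > 0" by simp
  have "p ((1/c) *\<^sub>R (c *\<^sub>R x)) \<le> (1/c) * p (c *\<^sub>R x)"
    using c by (intro sublinear_scale_le assms) auto
  then have "c * p x \<le> p (c *\<^sub>R x)" using c by (simp add: field_simps)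
  then show ?thesis using sublinear_scale_le[OF assms, of x] by simp
qed

lemma sublinear_minus: "sublinear p \<Longrightarrow> - p (- x) \<le> p x"
  using sublinear_add[of p x "-x"] sublinear_zero[of p] by simp

text \<open>The new functional is \<open>q y = (INF t\<in>{0..}. p (y + t *\<^sub>R x) - t * p x)\<close>, the largest
sublinear functional below \<open>p\<close> with \<open>q (- x) \<le> - p x\<close>. For a minimal \<open>p\<close> it must
coincide with \<open>p\<close>, which makes \<open>p\<close> linear; for an arbitrary \<open>p\<close> it forces every linear functional
below \<open>q\<close> to attain \<open>p x\<close> at \<open>x\<close>.\<close>

lemma sublinear_shrink:
  fixes p :: "'a::real_vector \<Rightarrow> real"
  assumes p: "sublinear p"
  obtains q where "sublinear q" "\<And>y. q y \<le> p y" "\<And>y. q y \<le> p (y + x) - p x"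
proof
  define q where "q = (\<lambda>y. INF t\<in>{0..}. p (y + t *\<^sub>R x) - t * p x)"
  have lower: "- p (- y) \<le> p (y + t *\<^sub>R x) - t * p x" if "t \<ge> 0" for y t
    using sublinear_add[OF p, of "y + t *\<^sub>R x" "- y"] sublinear_scale[OF p that, of x] by simp
  have bdd: "bdd_below ((\<lambda>t. p (y + t *\<^sub>R x) - t * p x) ` {0..})" for y
    using lower[of _ y] by (intro bdd_belowI2[where m = "- p (- y)"]) auto
  have q_le: "q y \<le> p (y + t *\<^sub>R x) - t * p x" if "t \<ge> 0" for y t
    unfolding q_def using that by (intro cINF_lower bdd) auto
  have q_ge: "m \<le> q y" if "\<And>t. t \<ge> 0 \<Longrightarrow> m \<le> p (y + t *\<^sub>R x) - t * p x" for m y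
    unfolding q_def using that by (intro cINF_greatest) auto
  show "q y \<le> p y" for y using q_le[of 0 y] by simp
  show "q y \<le> p (y + x) - p x" for y using q_le[of 1 y] by simp
  have "q (y + z) \<le> q y + q z" for y z
  proof -
    have "q (y + z) - q y \<le> q z"
    proof (rule q_ge)
      fix t :: real assume t: "t \<ge> 0"
      have "q (y + z) - (p (z + t *\<^sub>R x) - t * p x) \<le> q y"
      proof (rule q_ge)
        fix s :: real assume s: "s \<ge> 0"
        have "q (y + z) \<le> p (y + z + (s + t) *\<^sub>R x) - (s + t) * p x"
          using s t by (intro q_le) auto
        also have "y + z + (s + t) *\<^sub>R x = (y + s *\<^sub>R x) + (z + t *\<^sub>R x)"
          by (simp add: algebra_simps)
        also have "p \<dots> \<le> p (y + s *\<^sub>R x) + p (z + t *\<^sub>R x)" by (rule sublinear_add[OF p])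
        finally show "q (y + z) - (p (z + t *\<^sub>R x) - t * p x) \<le> p (y + s *\<^sub>R x) - s * p x"
          by (simp add: algebra_simps)
      qed
      then show "q (y + z) - q y \<le> p (z + t *\<^sub>R x) - t * p x" by simp
    qed
    then show ?thesis by simp
  qed
  moreover have "q (c *\<^sub>R y) \<le> c * q y" if "c \<ge> 0" for c y
  proof (cases "c = 0")
    case True
    have "q 0 \<le> 0" using q_le[of 0 0] sublinear_zero[OF p] by simp
    then show ?thesis using True by simp
  next
    case False
    with that have c: "c > 0" by simp
    have "q (c *\<^sub>R y) / c \<le> q y"
    proof (rule q_ge)
      fix t :: real assume t: "t \<ge> 0"
      have "q (c *\<^sub>R y) \<le> p (c *\<^sub>R y + (c * t) *\<^sub>R x) - (c * t) * p x"
        using c t by (intro q_le) auto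
      also have "c *\<^sub>R y + (c * t) *\<^sub>R x = c *\<^sub>R (y + t *\<^sub>R x)" by (simp add: algebra_simps)
      also have "p \<dots> = c * p (y + t *\<^sub>R x)" using c by (intro sublinear_scale p) simp
      finally show "q (c *\<^sub>R y) / c \<le> p (y + t *\<^sub>R x) - t * p x"
        using c by (simp add: field_simps)
    qed
    then show ?thesis using c by (simp add: field_simps)
  qed
  ultimately show "sublinear q" by (auto simp: sublinear_def)
qed

text \<open>Zorn's lemma: a chain has its pointwise infimum as lower bound. The infimum is finite because
\<open>- p (- x)\<close> bounds every sublinear functional below \<open>p\<close> from below at \<open>x\<close>, and it is subadditive because
of any two members of the chain one lies below the other.\<close>

lemma minimal_sublinear_exists:
  fixes p :: "'a::real_vector \<Rightarrow> real"
  assumes p: "sublinear p"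
  obtains m where "sublinear m" "m \<le> p" "\<And>q. sublinear q \<Longrightarrow> q \<le> m \<Longrightarrow> q = m"
proof -
  define S where "S = {q. sublinear q \<and> q \<le> p}"
  \<comment> \<open>The order is reversed, so that the maximal element of Zorn's lemma is a minimal functional.\<close>
  have "\<exists>m\<in>S. \<forall>q\<in>S. q \<le> m \<longrightarrow> q = m"
  proof (rule predicate_Zorn)
    show "partial_order_on S (relation_of (\<lambda>a b. b \<le> a) S)"
      by (rule partial_order_on_relation_ofI) auto
  next
    fix C assume "C \<in> Chains (relation_of (\<lambda>a b. b \<le> a) S)"
    then have CS: "C \<subseteq> S" and chain: "\<And>a b. a \<in> C \<Longrightarrow> b \<in> C \<Longrightarrow> a \<le> b \<or> b \<le> a"
      by (auto simp: Chains_def relation_of_def)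
    show "\<exists>r\<in>S. \<forall>q\<in>C. r \<le> q"
    proof (cases "C = {}")
      case True
      then show ?thesis using p by (auto simp: S_def)
    next
      case False
      have bdd: "bdd_below ((\<lambda>q. q x) ` C)" for x
      proof (rule bdd_belowI2)
        fix q assume "q \<in> C"
        with CS have "sublinear q" "q (- x) \<le> p (- x)" by (auto simp: S_def le_fun_def)
        then show "- p (- x) \<le> q x" using sublinear_minus[of q x] by linarith
      qed
      define r where "r = (\<lambda>x. INF q\<in>C. q x)"
      have r_le: "r x \<le> q x" if "q \<in> C" for q x
        unfolding r_def using that by (intro cINF_lower bdd) auto
      have r_ge: "m \<le> r x" if "\<And>q. q \<in> C \<Longrightarrow> m \<le> q x" for m x
        unfolding r_def using that False by (intro cINF_greatest) auto
      have "r (x + y) \<le> r x + r y" for x y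
      proof -
        have "r (x + y) - r x \<le> r y"
        proof (rule r_ge)
          fix q1 assume q1: "q1 \<in> C"
          have "r (x + y) - q1 y \<le> r x"
          proof (rule r_ge)
            fix q2 assume q2: "q2 \<in> C"
            from chain[OF q1 q2] obtain q where q: "q \<in> C" "q \<le> q1" "q \<le> q2"
              using q1 q2 by auto
            have "r (x + y) \<le> q (x + y)" using q by (intro r_le)
            also have "\<dots> \<le> q x + q y" using q CS by (intro sublinear_add) (auto simp: S_def)
            also have "\<dots> \<le> q2 x + q1 y" using q by (auto simp: le_fun_def intro: add_mono)
            finally show "r (x + y) - q1 y \<le> q2 x" by simp
          qed
          then show "r (x + y) - r x \<le> q1 y" by simp
        qed
        then show ?thesis by simp
      qed
      moreover have "r (c *\<^sub>R x) \<le> c * r x" if "c \<ge> 0" for c x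
      proof (cases "c = 0")
        case True
        obtain q where "q \<in> C" using False by auto
        then show ?thesis using r_le[of q 0] True sublinear_zero[of q] CS by (auto simp: S_def)
      next
        case False
        with that have c: "c > 0" by simp
        have "r (c *\<^sub>R x) / c \<le> r x"
        proof (rule r_ge)
          fix q assume q: "q \<in> C"
          then have "sublinear q" using CS by (auto simp: S_def)
          then have "r (c *\<^sub>R x) \<le> c * q x"
            using r_le[OF q, of "c *\<^sub>R x"] sublinear_scale_le[of q c x] c by simp
          then show "r (c *\<^sub>R x) / c \<le> q x" using c by (simp add: field_simps)
        qed
        then show ?thesis using c by (simp add: field_simps)
      qed
      ultimately have "sublinear r" by (auto simp: sublinear_def)
      moreover obtain q where "q \<in> C" using False by auto
      then have "r \<le> p" using CS r_le[of q] by (force simp: S_def le_fun_def intro: order_trans)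
      ultimately show ?thesis using r_le by (auto simp: S_def le_fun_def intro!: bexI[of _ r])
    qed
  qed
  then obtain m where m: "m \<in> S" "\<And>q. q \<in> S \<Longrightarrow> q \<le> m \<Longrightarrow> q = m" by blast
  show ?thesis
  proof
    show "sublinear m" "m \<le> p" using m by (auto simp: S_def)
    show "q = m" if "sublinear q" "q \<le> m" for q
      using that m by (intro m(2)) (auto simp: S_def)
  qed
qed

text \<open>The analytic Hahn-Banach theorem in the form of a supporting functional: a minimal sublinear
functional below the shrunken \<open>p\<close> is linear, and shrinking beforehand in the direction \<open>x\<close> fixes
its value at \<open>x\<close>.\<close>

lemma sublinear_dominates_linear:
  fixes p :: "'a::real_vector \<Rightarrow> real"
  assumes p: "sublinear p"
  obtains g where "linear g" "\<And>y. g y \<le> p y" "g x = p x"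
proof -
  obtain p' where p': "sublinear p'" "\<And>y. p' y \<le> p y" "\<And>y. p' y \<le> p (y + x) - p x"
    using sublinear_shrink[OF p, of x] by metis
  obtain m where m: "sublinear m" "m \<le> p'" "\<And>q. sublinear q \<Longrightarrow> q \<le> m \<Longrightarrow> q = m"
    using minimal_sublinear_exists[OF p'(1)] by metis
  have add: "m (y + z) = m y + m z" for y z
  proof -
    obtain q where q: "sublinear q" "\<And>y. q y \<le> m y" "\<And>y. q y \<le> m (y + z) - m z"
      using sublinear_shrink[OF m(1), of z] by metis
    have "q = m" using q by (intro m(3)) (auto simp: le_fun_def)
    then show ?thesis using q(3)[of y] sublinear_add[OF m(1), of y z] by simp
  qed
  have neg: "m (- y) = - m y" for y
    using add[of y "- y"] sublinear_zero[OF m(1)] by simp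
  have "m (c *\<^sub>R y) = c * m y" for c y
  proof (cases "c \<ge> 0")
    case True
    then show ?thesis by (rule sublinear_scale[OF m(1)])
  next
    case False
    then have "m ((- c) *\<^sub>R y) = (- c) * m y" by (intro sublinear_scale m(1)) simp
    then show ?thesis using neg[of "c *\<^sub>R y"] by simp
  qed
  then have "linear m" using add by (intro linearI) auto
  moreover have below: "m y \<le> p y" for y
    using m(2) p'(2)[of y] by (auto simp: le_fun_def intro: order_trans)
  moreover have "m x = p x"
  proof -
    have "m (- x) \<le> p' (- x)" using m(2) by (auto simp: le_fun_def)
    also have "\<dots> \<le> - p x" using p'(3)[of "- x"] sublinear_zero[OF p] by simp
    finally show ?thesis using neg[of x] below[of x] by simp
  qed
  ultimately show ?thesis by (rule that)
qed

section \<open>Clarke derivatives of locally Lipschitz functions\<close>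

lemma difference_quotient_bound:
  fixes j :: "'a::real_normed_vector \<Rightarrow> real"
  assumes "loc_lipschitz j"
  shows "\<exists>L\<ge>0. \<forall>v. \<forall>\<^sub>F (y, l) in nhds x \<times>\<^sub>F at_right 0.
    \<bar>(j (y + l *\<^sub>R v) - j y) / l\<bar> \<le> L * norm v"
proof -
  obtain e L where e: "e > 0" and L: "L-lipschitz_on (ball x e) j"
    using assms unfolding loc_lipschitz_def by metis
  have "\<forall>\<^sub>F (y, l) in nhds x \<times>\<^sub>F at_right 0. \<bar>(j (y + l *\<^sub>R v) - j y) / l\<bar> \<le> L * norm v" for v
  proof -
    have fst: "(fst \<longlongrightarrow> x) (nhds x \<times>\<^sub>F at_right (0::real))" by (rule filterlim_fst)
    have snd: "filterlim snd (at_right 0) (nhds x \<times>\<^sub>F at_right (0::real))" by (rule filterlim_snd)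
    then have snd0: "(snd \<longlongrightarrow> (0::real)) (nhds x \<times>\<^sub>F at_right 0)"
      by (rule filterlim_mono) (auto simp: at_within_le_nhds)
    have "((\<lambda>p. fst p + snd p *\<^sub>R v) \<longlongrightarrow> x + 0 *\<^sub>R v) (nhds x \<times>\<^sub>F at_right 0)"
      by (intro tendsto_intros fst snd0)
    then have "\<forall>\<^sub>F p in nhds x \<times>\<^sub>F at_right 0. fst p + snd p *\<^sub>R v \<in> ball x e"
      using e by (intro topological_tendstoD) auto
    moreover have "\<forall>\<^sub>F p in nhds x \<times>\<^sub>F at_right (0::real). fst p \<in> ball x e"
      using e by (intro topological_tendstoD[OF fst]) auto
    moreover have "\<forall>\<^sub>F p in nhds x \<times>\<^sub>F at_right (0::real). snd p > 0"
      using snd by (auto simp: filterlim_at elim: eventually_mono)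
    ultimately show ?thesis
    proof eventually_elim
      case (elim p)
      have "\<bar>j (fst p + snd p *\<^sub>R v) - j (fst p)\<bar> \<le> L * norm (snd p *\<^sub>R v)"
        using lipschitz_onD[OF L elim(1,2)] by (simp add: dist_real_def dist_norm)
      then show ?case using elim(3) by (auto simp: case_prod_unfold field_simps)
    qed
  qed
  moreover have "L \<ge> 0" using L by (rule lipschitz_on_nonneg)
  ultimately show ?thesis by blast
qed

text \<open>The extended-real upper limit in the definition of the Clarke derivative is finite here, so it can be
handled through eventual strict bounds on the difference quotients. All properties below are
consequences of this description.\<close>

lemma clarke_deriv_le_iff:
  fixes j :: "'a::real_normed_vector \<Rightarrow> real"
  assumes j: "loc_lipschitz j"
  shows "clarke_deriv j x v \<le> c \<longleftrightarrow>
    (\<forall>b>c. \<forall>\<^sub>F (y, l) in nhds x \<times>\<^sub>F at_right 0. (j (y + l *\<^sub>R v) - j y) / l < b)"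
proof -
  let ?F = "nhds x \<times>\<^sub>F at_right (0::real)"
  let ?Q = "\<lambda>(y, l). ereal ((j (y + l *\<^sub>R v) - j y) / l)"
  obtain L where L: "\<forall>\<^sub>F (y, l) in ?F. \<bar>(j (y + l *\<^sub>R v) - j y) / l\<bar> \<le> L * norm v"
    using difference_quotient_bound[OF j, of x] by blast
  have nb: "?F \<noteq> bot" by (simp add: prod_filter_eq_bot)
  have "Limsup ?F ?Q \<le> ereal (L * norm v)"
    using L by (intro Limsup_bounded) (auto simp: abs_le_iff simp del: abs_divide elim!: eventually_mono)
  moreover have "ereal (- (L * norm v)) \<le> Liminf ?F ?Q"
    using L by (intro Liminf_bounded) (auto simp: abs_le_iff minus_le_iff simp del: abs_divide elim!: eventually_mono)
  then have "ereal (- (L * norm v)) \<le> Limsup ?F ?Q"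
    using Liminf_le_Limsup[OF nb, of ?Q] by order
  ultimately obtain r where r: "Limsup ?F ?Q = ereal r" by (cases "Limsup ?F ?Q") auto
  have "clarke_deriv j x v \<le> c \<longleftrightarrow> Limsup ?F ?Q \<le> ereal c"
    unfolding clarke_deriv_def r by simp
  also have "\<dots> \<longleftrightarrow> (\<forall>b>c. \<forall>\<^sub>F (y, l) in ?F. (j (y + l *\<^sub>R v) - j y) / l < b)"
  proof (intro iffI allI impI)
    fix b assume "Limsup ?F ?Q \<le> ereal c" "b > c"
    then have "\<forall>\<^sub>F p in ?F. ?Q p < ereal b" by (simp add: Limsup_le_iff)
    then show "\<forall>\<^sub>F (y, l) in ?F. (j (y + l *\<^sub>R v) - j y) / l < b"
      by (auto elim!: eventually_mono)
  next
    assume ev: "\<forall>b>c. \<forall>\<^sub>F (y, l) in ?F. (j (y + l *\<^sub>R v) - j y) / l < b"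
    show "Limsup ?F ?Q \<le> ereal c"
    proof (rule ereal_le_epsilon2)
      fix e :: real assume "e > 0"
      then have "\<forall>\<^sub>F (y, l) in ?F. (j (y + l *\<^sub>R v) - j y) / l < c + e" using ev by simp
      then show "Limsup ?F ?Q \<le> ereal c + ereal e"
        by (intro Limsup_bounded) (auto elim!: eventually_mono)
    qed
  qed
  finally show ?thesis .
qed

text \<open>The quotient in direction \<open>v + w\<close> at \<open>y\<close> is the sum of the quotient in direction \<open>v\<close> at the shifted
base point \<open>y + l *\<^sub>R w\<close> and the quotient in direction \<open>w\<close> at \<open>y\<close>. The shifted base point still tends
to \<open>x\<close>; this is where it matters that the base point varies in the definition.\<close>

lemma clarke_deriv_subadditive:
  fixes j :: "'a::real_normed_vector \<Rightarrow> real"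
  assumes j: "loc_lipschitz j"
  shows "clarke_deriv j x (v + w) \<le> clarke_deriv j x v + clarke_deriv j x w"
  unfolding clarke_deriv_le_iff[OF j, of x "v + w"]
proof (intro allI impI)
  let ?F = "nhds x \<times>\<^sub>F at_right (0::real)"
  fix b assume b: "b > clarke_deriv j x v + clarke_deriv j x w"
  define e where "e = (b - (clarke_deriv j x v + clarke_deriv j x w)) / 2"
  have e: "e > 0" using b by (simp add: e_def)
  have ev: "\<forall>\<^sub>F (y, l) in ?F. (j (y + l *\<^sub>R z) - j y) / l < clarke_deriv j x z + e" for z
    using clarke_deriv_le_iff[OF j, of x z "clarke_deriv j x z"] e by simp
  have fst: "(fst \<longlongrightarrow> x) ?F" by (rule filterlim_fst)
  have snd: "filterlim snd (at_right 0) ?F" by (rule filterlim_snd)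
  then have snd0: "(snd \<longlongrightarrow> (0::real)) ?F"
    by (rule filterlim_mono) (auto simp: at_within_le_nhds)
  have "((\<lambda>p. fst p + snd p *\<^sub>R w) \<longlongrightarrow> x + 0 *\<^sub>R w) ?F" by (intro tendsto_intros fst snd0)
  then have "filterlim (\<lambda>p. (fst p + snd p *\<^sub>R w, snd p)) ?F ?F"
    using snd by (intro filterlim_Pair) auto
  then have "\<forall>\<^sub>F p in ?F. (case (fst p + snd p *\<^sub>R w, snd p) of (y, l) \<Rightarrow>
      (j (y + l *\<^sub>R v) - j y) / l < clarke_deriv j x v + e)"
    using ev[of v] by (auto simp: filterlim_iff)
  with ev[of w] show "\<forall>\<^sub>F (y, l) in ?F. (j (y + l *\<^sub>R (v + w)) - j y) / l < b"
  proof eventually_elim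
    case (elim p)
    obtain y l where p: "p = (y, l)" by (cases p)
    have eq: "y + l *\<^sub>R (v + w) = (y + l *\<^sub>R w) + l *\<^sub>R v" by (simp add: algebra_simps)
    have "(j (y + l *\<^sub>R (v + w)) - j y) / l
        = (j ((y + l *\<^sub>R w) + l *\<^sub>R v) - j (y + l *\<^sub>R w)) / l + (j (y + l *\<^sub>R w) - j y) / l"
      unfolding eq by (simp add: diff_divide_distrib)
    also have "\<dots> < (clarke_deriv j x v + e) + (clarke_deriv j x w + e)"
      using elim unfolding p by (intro add_strict_mono) auto
    also have "\<dots> = b" by (simp add: e_def field_simps)
    finally show ?case by (simp add: p)
  qed
qed

lemma clarke_deriv_scale_le:
  fixes j :: "'a::real_normed_vector \<Rightarrow> real"
  assumes j: "loc_lipschitz j" and c: "c \<ge> 0"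
  shows "clarke_deriv j x (c *\<^sub>R v) \<le> c * clarke_deriv j x v"
proof (cases "c = 0")
  case True
  then show ?thesis by (simp add: clarke_deriv_le_iff[OF j] case_prod_unfold)
next
  case False
  with c have c: "c > 0" by simp
  let ?F = "nhds x \<times>\<^sub>F at_right (0::real)"
  show ?thesis
    unfolding clarke_deriv_le_iff[OF j, of x "c *\<^sub>R v"]
  proof (intro allI impI)
    fix b assume b: "b > c * clarke_deriv j x v"
    have ev: "\<forall>\<^sub>F (y, l) in ?F. (j (y + l *\<^sub>R v) - j y) / l < b / c"
      proof -
      have "b / c > clarke_deriv j x v" using b c by (simp add: field_simps)
      then show ?thesis using clarke_deriv_le_iff[OF j, of x v "clarke_deriv j x v"] by simp
    qed
    have "filterlim (\<lambda>l. c * l) (at_right 0) (at_right 0)"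
      using c by (auto simp: filterlim_at eventually_at_right_less
        intro!: tendsto_eq_intros eventually_at_rightI[of 0 1])
    from filterlim_compose[OF this filterlim_snd]
    have "filterlim (\<lambda>p. (fst p, c * snd p)) ?F ?F"
      by (intro filterlim_Pair filterlim_fst)
    then have "\<forall>\<^sub>F p in ?F. (case (fst p, c * snd p) of (y, l) \<Rightarrow>
        (j (y + l *\<^sub>R v) - j y) / l < b / c)"
      using ev by (auto simp: filterlim_iff)
    then show "\<forall>\<^sub>F (y, l) in ?F. (j (y + l *\<^sub>R c *\<^sub>R v) - j y) / l < b"
    proof eventually_elim
      case (elim p)
      then have "(j (fst p + (snd p * c) *\<^sub>R v) - j (fst p)) / (c * snd p) * c < b"
        using c by (simp add: case_prod_unfold pos_less_divide_eq mult.commute)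
      then show ?case using c by (simp add: case_prod_unfold)
    qed
  qed
qed

text \<open>The growth hypothesis of the problem speaks about subgradients, while the error analysis needs to
bound directional derivatives. The bridge is \<open>j\<^sup>0(x; v) = max {\<langle>\<xi>, v\<rangle> | \<xi> \<in> \<partial>j(x)}\<close>: a linear functional
below the Clarke derivative that attains it at \<open>v\<close> is bounded by the local Lipschitz constant,
hence a subgradient.\<close>

lemma clarke_deriv_growth:
  fixes j :: "'a::real_normed_vector \<Rightarrow> real"
  assumes j: "loc_lipschitz j"
    and growth: "\<And>\<xi>. \<xi> \<in> clarke_subdiff j x \<Longrightarrow> norm \<xi> \<le> c"
  shows "\<bar>clarke_deriv j x v\<bar> \<le> c * norm v"
proof -
  have sub: "sublinear (clarke_deriv j x)"
    using clarke_deriv_subadditive[OF j] clarke_deriv_scale_le[OF j] by (auto simp: sublinear_def)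
  obtain L where L: "L \<ge> 0" and ev: "\<And>v. \<forall>\<^sub>F (y, l) in nhds x \<times>\<^sub>F at_right 0.
      \<bar>(j (y + l *\<^sub>R v) - j y) / l\<bar> \<le> L * norm v"
    using difference_quotient_bound[OF j, of x] by blast
  have bound: "clarke_deriv j x v \<le> L * norm v" for v
    unfolding clarke_deriv_le_iff[OF j] using ev[of v]
    by (auto simp: abs_le_iff simp del: abs_divide elim!: eventually_mono)
  have upper: "clarke_deriv j x v \<le> c * norm v" for v
  proof -
    obtain g where g: "linear g" "\<And>y. g y \<le> clarke_deriv j x y" "g v = clarke_deriv j x v"
      using sublinear_dominates_linear[OF sub, of v] by metis
    have "norm (g y) \<le> norm y * L" for y
    proof -
      have "g y \<le> L * norm y" "g (- y) \<le> L * norm (- y)"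
        using g(2) bound order_trans by blast+
      then show ?thesis using linear_neg[OF g(1), of y] by (simp add: abs_le_iff mult.commute)
    qed
    \<comment> \<open>The Lipschitz constant makes the supporting functional bounded, i.e. an element of the dual.\<close>
    then have "bounded_linear g"
      using g(1) by (intro bounded_linear_intro[where K = L]) (auto simp: linear_add linear_scale)
    then have app: "blinfun_apply (Blinfun g) = g" by (rule bounded_linear_Blinfun_apply)
    have "Blinfun g \<in> clarke_subdiff j x" using g(2) by (simp add: clarke_subdiff_def app)
    from growth[OF this] have "norm (Blinfun g) \<le> c" .
    then have "norm (Blinfun g) * norm v \<le> c * norm v" by (intro mult_right_mono) auto
    moreover have "g v \<le> norm (Blinfun g) * norm v"
      using norm_blinfun[of "Blinfun g" v] by (simp add: app)
    ultimately show ?thesis using g(3) by simp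
  qed
  show ?thesis using upper[of v] upper[of "- v"] sublinear_minus[OF sub, of v] by simp
qed

section \<open>Splines as test functions\<close>

definition pos_part :: "real \<Rightarrow> real" where "pos_part s = max 0 s"

text \<open>The powers are at least the second, so that the function is differentiable at the kink \<open>c\<close> as well.\<close>

lemma pos_part_power_derivative:
  "((\<lambda>s. pos_part (s - c) ^ Suc (Suc n)) has_real_derivative
     real (Suc (Suc n)) * pos_part (s - c) ^ Suc n) (at s)"
proof -
  consider "s < c" | "s > c" | "s = c" by linarith
  then show ?thesis
  proof cases
    case 1
    have "((\<lambda>s. 0) has_real_derivative 0) (at s)" by simp
    then have "((\<lambda>s. pos_part (s - c) ^ Suc (Suc n)) has_real_derivative 0) (at s)"
      by (rule has_field_derivative_transform_within_open[where S = "{..<c}"])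
        (use 1 in \<open>auto simp: pos_part_def\<close>)
    then show ?thesis using 1 by (simp add: pos_part_def)
  next
    case 2
    have "((\<lambda>s. (s - c) ^ Suc (Suc n)) has_real_derivative
        real (Suc (Suc n)) * (s - c) ^ Suc n) (at s)"
      by (rule derivative_eq_intros refl | simp)+
    then have "((\<lambda>s. pos_part (s - c) ^ Suc (Suc n)) has_real_derivative
        real (Suc (Suc n)) * (s - c) ^ Suc n) (at s)"
      by (rule has_field_derivative_transform_within_open[where S = "{c<..}"])
        (use 2 in \<open>auto simp: pos_part_def\<close>)
    then show ?thesis using 2 by (simp add: pos_part_def)
  next
    case 3
    have "((\<lambda>y. pos_part (y - c) ^ Suc n) \<longlongrightarrow> pos_part (c - c) ^ Suc n) (at c)"
      unfolding pos_part_def by (intro tendsto_intros)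
    then have "((\<lambda>y. pos_part (y - c) ^ Suc n) \<longlongrightarrow> 0) (at c)" by (simp add: pos_part_def)
    then have "((\<lambda>y. (pos_part (y - c) ^ Suc (Suc n)) / (y - c)) \<longlongrightarrow> 0) (at c)"
      by (rule Lim_transform_eventually)
        (auto simp: eventually_at_filter pos_part_def max_def intro!: always_eventually)
    then show ?thesis using 3
      by (simp add: has_field_derivative_iff pos_part_def)
  qed
qed

text \<open>A hat of width \<open>2 * \<epsilon>\<close> with mass \<open>\<epsilon>\<^sup>2\<close>, followed by its two primitives that vanish on the left. All three
are second differences of truncated powers, so derivatives come from
\<open>pos_part_power_derivative\<close> alone. To the right of \<open>\<epsilon>\<close> the second primitive is linear, hence differences of
hats at two points have compactly supported primitives, and second differences of hats have
compactly supported second primitives.\<close>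

definition hat :: "real \<Rightarrow> real \<Rightarrow> real" where
  "hat \<epsilon> s = pos_part (s + \<epsilon>) - 2 * pos_part s + pos_part (s - \<epsilon>)"

definition hat_primitive :: "real \<Rightarrow> real \<Rightarrow> real" where
  "hat_primitive \<epsilon> s = (pos_part (s + \<epsilon>) ^ 2 - 2 * pos_part s ^ 2 + pos_part (s - \<epsilon>) ^ 2) / 2"

definition hat_primitive2 :: "real \<Rightarrow> real \<Rightarrow> real" where
  "hat_primitive2 \<epsilon> s = (pos_part (s + \<epsilon>) ^ 3 - 2 * pos_part s ^ 3 + pos_part (s - \<epsilon>) ^ 3) / 6"

lemma continuous_on_hat [continuous_intros]:
  "continuous_on S g \<Longrightarrow> continuous_on S (\<lambda>s. hat \<epsilon> (g s))"
  unfolding hat_def pos_part_def by (intro continuous_intros)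

lemma hat_primitive_derivative:
  "((\<lambda>s. hat_primitive \<epsilon> (s - c)) has_real_derivative hat \<epsilon> (s - c)) (at s)"
proof -
  have *: "((\<lambda>s. pos_part (s - d) ^ 2) has_real_derivative 2 * pos_part (s - d)) (at s)" for d
    using pos_part_power_derivative[of d 0 s] by (simp add: numeral_2_eq_2)
  have "((\<lambda>s. (pos_part (s - (c - \<epsilon>)) ^ 2 - 2 * pos_part (s - c) ^ 2 + pos_part (s - (c + \<epsilon>)) ^ 2) / 2)
     has_real_derivative (2 * pos_part (s - (c - \<epsilon>)) - 2 * (2 * pos_part (s - c)) + 2 * pos_part (s - (c + \<epsilon>))) / 2) (at s)"
    by (intro DERIV_cdivide DERIV_add DERIV_diff DERIV_cmult *)
  then show ?thesis by (simp add: hat_primitive_def hat_def algebra_simps add_divide_distrib diff_divide_distrib)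
qed

lemma hat_primitive2_derivative:
  "((\<lambda>s. hat_primitive2 \<epsilon> (s - c)) has_real_derivative hat_primitive \<epsilon> (s - c)) (at s)"
proof -
  have *: "((\<lambda>s. pos_part (s - d) ^ 3) has_real_derivative 3 * pos_part (s - d) ^ 2) (at s)" for d
    using pos_part_power_derivative[of d 1 s] by (simp add: numeral_2_eq_2 numeral_3_eq_3)
  have "((\<lambda>s. (pos_part (s - (c - \<epsilon>)) ^ 3 - 2 * pos_part (s - c) ^ 3 + pos_part (s - (c + \<epsilon>)) ^ 3) / 6)
     has_real_derivative (3 * pos_part (s - (c - \<epsilon>)) ^ 2 - 2 * (3 * pos_part (s - c) ^ 2) + 3 * pos_part (s - (c + \<epsilon>)) ^ 2) / 6) (at s)"
    by (intro DERIV_cdivide DERIV_add DERIV_diff DERIV_cmult *)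
  then show ?thesis by (simp add: hat_primitive2_def hat_primitive_def algebra_simps add_divide_distrib diff_divide_distrib)
qed

lemma hat_nonneg: "hat \<epsilon> s \<ge> 0"
  by (auto simp: hat_def pos_part_def max_def)

lemma hat_eq_0: "\<epsilon> > 0 \<Longrightarrow> s \<notin> {-\<epsilon>..\<epsilon>} \<Longrightarrow> hat \<epsilon> s = 0"
  by (auto simp: hat_def pos_part_def max_def)

lemma hat_primitive_left: "\<epsilon> > 0 \<Longrightarrow> s \<le> -\<epsilon> \<Longrightarrow> hat_primitive \<epsilon> s = 0"
  by (auto simp: hat_primitive_def pos_part_def max_def)

lemma hat_primitive_right: "\<epsilon> > 0 \<Longrightarrow> s \<ge> \<epsilon> \<Longrightarrow> hat_primitive \<epsilon> s = \<epsilon>\<^sup>2"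
  by (auto simp: hat_primitive_def pos_part_def max_def power2_eq_square algebra_simps)

lemma hat_primitive2_left: "\<epsilon> > 0 \<Longrightarrow> s \<le> -\<epsilon> \<Longrightarrow> hat_primitive2 \<epsilon> s = 0"
  by (auto simp: hat_primitive2_def pos_part_def max_def)

lemma hat_primitive2_right: "\<epsilon> > 0 \<Longrightarrow> s \<ge> \<epsilon> \<Longrightarrow> hat_primitive2 \<epsilon> s = \<epsilon>\<^sup>2 * s"
  by (auto simp: hat_primitive2_def pos_part_def max_def power2_eq_square power3_eq_cube algebra_simps)

lemma hat_primitive_mono: "s \<le> t \<Longrightarrow> hat_primitive \<epsilon> s \<le> hat_primitive \<epsilon> t"
  using hat_primitive_derivative[of \<epsilon> 0] hat_nonneg[of \<epsilon>]
  by (intro DERIV_nonneg_imp_nondecreasing[of s t "hat_primitive \<epsilon>"]) auto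

lemma hat_primitive_bounds:
  assumes "\<epsilon> > 0"
  shows "0 \<le> hat_primitive \<epsilon> s" "hat_primitive \<epsilon> s \<le> \<epsilon>\<^sup>2"
  using hat_primitive_mono[of "min s (- \<epsilon>)" s \<epsilon>] hat_primitive_left[OF assms, of "min s (- \<epsilon>)"]
    hat_primitive_mono[of s "max s \<epsilon>" \<epsilon>] hat_primitive_right[OF assms, of "max s \<epsilon>"] by auto

lemma hat_primitive2_lipschitz:
  assumes "\<epsilon> > 0"
  shows "\<bar>hat_primitive2 \<epsilon> s - hat_primitive2 \<epsilon> t\<bar> \<le> \<epsilon>\<^sup>2 * \<bar>s - t\<bar>"
  using field_differentiable_bound[of UNIV "hat_primitive2 \<epsilon>" "hat_primitive \<epsilon>" "\<epsilon>\<^sup>2" t s]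
    hat_primitive2_derivative[of \<epsilon> 0] hat_primitive_bounds[OF assms] by (simp add: abs_minus_commute)

lemma has_integral_norm_le:
  fixes f :: "'n::euclidean_space \<Rightarrow> 'a::banach"
  assumes "(f has_integral I) S" "(g has_integral J) S" "\<And>x. x \<in> S \<Longrightarrow> norm (f x) \<le> g x"
  shows "norm I \<le> J"
  using assms integral_norm_bound_integral[of f S g] by (auto simp: has_integral_iff)

section \<open>Finite differences of functions with bounded weak derivatives\<close>

text \<open>Averaging against the hat approximates a point value of a continuous function. Passing to the limit
\<open>\<epsilon> \<rightarrow> 0\<close> turns weak identities into pointwise finite differences.\<close>

lemma hat_average:
  fixes w :: "real \<Rightarrow> 'a::banach"
  assumes \<epsilon>: "\<epsilon> > 0" "c - \<epsilon> > 0" and cont: "continuous_on {0..} w"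
  obtains J where "((\<lambda>s. hat \<epsilon> (s - c) *\<^sub>R w s) has_integral J) {0<..}"
    "\<And>\<omega>. (\<And>s. \<bar>s - c\<bar> \<le> \<epsilon> \<Longrightarrow> norm (w s - w c) \<le> \<omega>) \<Longrightarrow> norm (J - \<epsilon>\<^sup>2 *\<^sub>R w c) \<le> \<omega> * \<epsilon>\<^sup>2"
proof
  let ?I = "{c - \<epsilon>..c + \<epsilon>}"
  define J where "J = integral ?I (\<lambda>s. hat \<epsilon> (s - c) *\<^sub>R w s)"
  have cw: "continuous_on ?I w" using cont by (rule continuous_on_subset) (use \<epsilon> in auto)
  have "(\<lambda>s. hat \<epsilon> (s - c) *\<^sub>R w s) integrable_on ?I"
    by (intro integrable_continuous_interval continuous_intros cw)
  then have J: "((\<lambda>s. hat \<epsilon> (s - c) *\<^sub>R w s) has_integral J) ?I"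
    unfolding J_def by (rule integrable_integral)
  then show "((\<lambda>s. hat \<epsilon> (s - c) *\<^sub>R w s) has_integral J) {0<..}"
    by (rule has_integral_on_superset) (use \<epsilon> in \<open>auto simp: hat_eq_0\<close>)
  have one: "((\<lambda>s. hat \<epsilon> (s - c)) has_integral \<epsilon>\<^sup>2) ?I"
  proof -
    have "((\<lambda>s. hat \<epsilon> (s - c)) has_integral
        (hat_primitive \<epsilon> (c + \<epsilon> - c) - hat_primitive \<epsilon> (c - \<epsilon> - c))) ?I"
      using \<epsilon> hat_primitive_derivative
      by (intro fundamental_theorem_of_calculus)
        (auto simp: has_real_derivative_iff_has_vector_derivative intro: has_vector_derivative_at_within)
    then show ?thesis using \<epsilon> by (simp add: hat_primitive_left hat_primitive_right)
  qed
  fix \<omega> assume \<omega>: "\<And>s. \<bar>s - c\<bar> \<le> \<epsilon> \<Longrightarrow> norm (w s - w c) \<le> \<omega>"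
  have "((\<lambda>s. hat \<epsilon> (s - c) *\<^sub>R w s - hat \<epsilon> (s - c) *\<^sub>R w c) has_integral (J - \<epsilon>\<^sup>2 *\<^sub>R w c)) ?I"
    by (intro has_integral_diff J has_integral_scaleR_left one)
  moreover have "((\<lambda>s. hat \<epsilon> (s - c) * \<omega>) has_integral (\<epsilon>\<^sup>2 * \<omega>)) ?I"
    by (intro has_integral_mult_left one)
  moreover have "norm (hat \<epsilon> (s - c) *\<^sub>R w s - hat \<epsilon> (s - c) *\<^sub>R w c) \<le> hat \<epsilon> (s - c) * \<omega>"
    if "s \<in> ?I" for s
  proof -
    have "norm (hat \<epsilon> (s - c) *\<^sub>R (w s - w c)) \<le> hat \<epsilon> (s - c) * \<omega>"
      using that \<omega>[of s] hat_nonneg[of \<epsilon> "s - c"] by (auto intro!: mult_left_mono)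
    then show ?thesis by (simp add: scaleR_diff_right)
  qed
  ultimately have "norm (J - \<epsilon>\<^sup>2 *\<^sub>R w c) \<le> \<epsilon>\<^sup>2 * \<omega>"
    by (rule has_integral_norm_le)
  then show "norm (J - \<epsilon>\<^sup>2 *\<^sub>R w c) \<le> \<omega> * \<epsilon>\<^sup>2" by (simp add: mult.commute)
qed

text \<open>The integral is given as a gauge integral, and the bound on \<open>g\<close> holds almost everywhere; redefining the
integrand on the exceptional null set leaves the integral unchanged and allows a pointwise comparison.\<close>

lemma norm_integral_test_fun_le:
  fixes g :: "real \<Rightarrow> 'a::banach"
  assumes ae: "AE t in lebesgue. 0 < t \<and> t < T \<longrightarrow> norm (g t) \<le> M" and "M \<ge> 0"
    and I: "((\<lambda>t. \<psi> t *\<^sub>R g t) has_integral I) {0<..}"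
    and supp: "0 < a" "a \<le> b" "b < T" "\<And>t. t \<notin> {a..b} \<Longrightarrow> \<psi> t = 0"
    and B: "\<And>t. \<bar>\<psi> t\<bar> \<le> B"
  shows "norm I \<le> B * M * (b - a)"
proof -
  obtain Z where Z: "Z \<in> null_sets lebesgue"
    "{t \<in> space lebesgue. \<not> (0 < t \<and> t < T \<longrightarrow> norm (g t) \<le> M)} \<subseteq> Z"
    using ae by (auto simp: eventually_ae_filter)
  have negl: "negligible Z" using Z(1) by (simp add: negligible_iff_null_sets)
  let ?G = "\<lambda>t. if t \<in> Z then 0 else \<psi> t *\<^sub>R g t"
  have "B \<ge> 0" using B[of a] by (rule order_trans[OF abs_ge_zero])
  have "(?G has_integral I) {0<..}"
    by (rule has_integral_spike[OF negl _ I]) auto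
  moreover have "((\<lambda>t. if t \<in> {a..b} then B * M else 0) has_integral (B * M * (b - a))) {0<..}"
  proof -
    have "((\<lambda>t. B * M) has_integral (B * M * (b - a))) {a..b}"
      using has_integral_const_real[of "B * M" a b] supp by (simp add: mult.commute)
    then have "((\<lambda>t. if t \<in> {a..b} then B * M else 0) has_integral (B * M * (b - a))) {a..b}"
      by (rule has_integral_eq[rotated]) auto
    then show ?thesis
      by (rule has_integral_on_superset) (use supp in auto)
  qed
  moreover have "norm (?G t) \<le> (if t \<in> {a..b} then B * M else 0)" if "t \<in> {0<..}" for t
  proof (cases "t \<in> {a..b}")
    case True
    then have "0 < t \<and> t < T" using supp(1,3) by auto
    then have "norm (g t) \<le> M" if "t \<notin> Z" using that Z(2) by auto
    then show ?thesis using True B[of t] \<open>M \<ge> 0\<close> \<open>B \<ge> 0\<close> by (auto intro!: mult_mono)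
  next
    case False
    then show ?thesis using supp(4)[OF False] by auto
  qed
  ultimately show ?thesis
    by (rule has_integral_norm_le)
qed

lemma Linf_loc_bound:
  assumes "Linf_loc g"
  obtains M where "M \<ge> 0" "AE t in lebesgue. 0 < t \<and> t < T \<longrightarrow> norm (g t) \<le> M"
proof (cases "T > 0")
  case True
  then obtain M where M: "AE t in lebesgue. 0 < t \<and> t < T \<longrightarrow> norm (g t) \<le> M"
    using assms by (auto simp: Linf_loc_def)
  have "AE t in lebesgue. 0 < t \<and> t < T \<longrightarrow> norm (g t) \<le> max 0 M"
    using M by eventually_elim auto
  then show ?thesis by (intro that[of "max 0 M"]) auto
qed (auto intro: that[of 0])

lemma continuous_on_nonneg_close:
  fixes w :: "real \<Rightarrow> 'a::real_normed_vector"
  assumes cont: "continuous_on {0..} w" and "c > 0" "\<omega> > 0"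
  shows "\<exists>d>0. \<forall>s. \<bar>s - c\<bar> \<le> d \<longrightarrow> norm (w s - w c) \<le> \<omega>"
proof -
  obtain d where d: "d > 0" "\<And>s. s \<ge> 0 \<Longrightarrow> dist s c < d \<Longrightarrow> dist (w s) (w c) < \<omega>"
    using cont assms(2,3) by (force simp: continuous_on_iff)
  have "norm (w s - w c) \<le> \<omega>" if "\<bar>s - c\<bar> \<le> min d c / 2" for s
  proof -
    have "\<bar>s - c\<bar> \<le> d / 2" "\<bar>s - c\<bar> \<le> c / 2" using that by linarith+
    then have "s \<ge> 0" "dist s c < d" using d(1) \<open>c > 0\<close> unfolding dist_real_def by linarith+
    then show ?thesis using d(2)[of s] by (simp add: dist_norm)
  qed
  then show ?thesis using d(1) \<open>c > 0\<close> by (intro exI[of _ "min d c / 2"]) auto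
qed

text \<open>Test with \<open>\<psi>\<close> whose derivative is the difference of hats at \<open>s\<close> and \<open>t\<close>: a smoothed indicator of
\<open>{s..t}\<close> of height \<open>\<epsilon>\<^sup>2\<close>. Division by \<open>\<epsilon>\<^sup>2\<close> and \<open>\<epsilon> \<rightarrow> 0\<close> give the estimate.\<close>

lemma weak_deriv_lipschitz:
  fixes w :: "real \<Rightarrow> 'a::banach"
  assumes cont: "continuous_on {0..} w" and wd: "weak_deriv w g" and "M \<ge> 0"
    and ae: "AE t in lebesgue. 0 < t \<and> t < T \<longrightarrow> norm (g t) \<le> M"
    and st: "0 < s" "s \<le> t" "t < T"
  shows "norm (w t - w s) \<le> M * (t - s)"
proof (rule field_le_epsilon)
  fix e :: real assume e: "e > 0"
  define \<omega> where "\<omega> = e / (2 + 2 * M)"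
  have \<omega>: "\<omega> > 0" using e \<open>M \<ge> 0\<close> by (simp add: \<omega>_def add_pos_nonneg)
  obtain d1 where d1: "d1 > 0" "\<And>r. \<bar>r - s\<bar> \<le> d1 \<Longrightarrow> norm (w r - w s) \<le> \<omega>"
    using continuous_on_nonneg_close[OF cont _ \<omega>, of s] st by auto
  obtain d2 where d2: "d2 > 0" "\<And>r. \<bar>r - t\<bar> \<le> d2 \<Longrightarrow> norm (w r - w t) \<le> \<omega>"
    using continuous_on_nonneg_close[OF cont _ \<omega>, of t] st by auto
  \<comment> \<open>The first two bounds keep the support of the test function inside the interval.\<close>
  define \<epsilon> where "\<epsilon> = Min {s, T - t, \<omega>, d1, d2} / 2"
  have "0 < Min {s, T - t, \<omega>, d1, d2}" using st \<omega> d1(1) d2(1) by simp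
  then have "0 < \<epsilon>" "\<epsilon> < Min {s, T - t, \<omega>, d1, d2}" unfolding \<epsilon>_def by linarith+
  then have \<epsilon>: "0 < \<epsilon>" "\<epsilon> < s" "\<epsilon> < T - t" "\<epsilon> < \<omega>" "\<epsilon> < d1" "\<epsilon> < d2"
    by simp_all
  have cl: "norm (w r - w s) \<le> \<omega>" if "\<bar>r - s\<bar> \<le> \<epsilon>" for r using that d1(2) \<epsilon> by auto
  have cl': "norm (w r - w t) \<le> \<omega>" if "\<bar>r - t\<bar> \<le> \<epsilon>" for r using that d2(2) \<epsilon> by auto
  obtain Js where Js: "((\<lambda>r. hat \<epsilon> (r - s) *\<^sub>R w r) has_integral Js) {0<..}"
    "norm (Js - \<epsilon>\<^sup>2 *\<^sub>R w s) \<le> \<omega> * \<epsilon>\<^sup>2"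
  proof (rule hat_average[OF \<epsilon>(1) _ cont, of s])
    show "s - \<epsilon> > 0" using \<epsilon> by simp
  qed (use cl in blast)
  obtain Jt where Jt: "((\<lambda>r. hat \<epsilon> (r - t) *\<^sub>R w r) has_integral Jt) {0<..}"
    "norm (Jt - \<epsilon>\<^sup>2 *\<^sub>R w t) \<le> \<omega> * \<epsilon>\<^sup>2"
  proof (rule hat_average[OF \<epsilon>(1) _ cont, of t])
    show "t - \<epsilon> > 0" using \<epsilon> st by simp
  qed (use cl' in blast)
  define \<psi> where "\<psi> = (\<lambda>r. hat_primitive \<epsilon> (r - s) - hat_primitive \<epsilon> (r - t))"
  define \<psi>' where "\<psi>' = (\<lambda>r. hat \<epsilon> (r - s) - hat \<epsilon> (r - t))"
  have supp: "\<psi> r = 0" if "r \<notin> {s - \<epsilon>..t + \<epsilon>}" for r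
    using that \<epsilon> st by (cases "r < s - \<epsilon>") (auto simp: \<psi>_def hat_primitive_left hat_primitive_right)
  have "test_fun \<psi> \<psi>'"
    unfolding test_fun_def
  proof (intro conjI allI exI)
    show "(\<psi> has_real_derivative \<psi>' r) (at r)" for r
      unfolding \<psi>_def \<psi>'_def by (intro DERIV_diff hat_primitive_derivative)
    show "continuous_on UNIV \<psi>'" unfolding \<psi>'_def by (intro continuous_intros)
    show "0 < s - \<epsilon>" "s - \<epsilon> \<le> t + \<epsilon>" using \<epsilon> st by auto
    show "r \<notin> {s - \<epsilon>..t + \<epsilon>} \<longrightarrow> \<psi> r = 0" for r using supp by blast
  qed
  then obtain I where I: "((\<lambda>r. \<psi>' r *\<^sub>R w r) has_integral I) {0<..}"
    "((\<lambda>r. \<psi> r *\<^sub>R g r) has_integral - I) {0<..}"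
    using wd unfolding weak_deriv_def by blast
  have "((\<lambda>r. \<psi>' r *\<^sub>R w r) has_integral (Js - Jt)) {0<..}"
    unfolding \<psi>'_def scaleR_diff_left by (intro has_integral_diff Js Jt)
  then have I_eq: "I = Js - Jt" using I(1) has_integral_unique by blast
  have "\<bar>\<psi> r\<bar> \<le> \<epsilon>\<^sup>2" for r
    using hat_primitive_bounds[OF \<epsilon>(1), of "r - s"] hat_primitive_bounds[OF \<epsilon>(1), of "r - t"]
    by (auto simp: \<psi>_def abs_le_iff)
  then have "norm (- I) \<le> \<epsilon>\<^sup>2 * M * (t + \<epsilon> - (s - \<epsilon>))"
    using \<epsilon> st supp by (intro norm_integral_test_fun_le[OF ae \<open>M \<ge> 0\<close> I(2)]) auto
  then have nI: "norm (Jt - Js) \<le> \<epsilon>\<^sup>2 * (M * (t - s + 2 * \<epsilon>))"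
    unfolding I_eq by (simp add: norm_minus_commute algebra_simps)
  have "\<epsilon>\<^sup>2 * norm (w t - w s) = norm (\<epsilon>\<^sup>2 *\<^sub>R w t - \<epsilon>\<^sup>2 *\<^sub>R w s)"
    by (simp flip: scaleR_diff_right)
  also have "\<dots> = norm ((Jt - Js) - (Jt - \<epsilon>\<^sup>2 *\<^sub>R w t) + (Js - \<epsilon>\<^sup>2 *\<^sub>R w s))" by simp
  also have "\<dots> \<le> norm (Jt - Js) + norm (Jt - \<epsilon>\<^sup>2 *\<^sub>R w t) + norm (Js - \<epsilon>\<^sup>2 *\<^sub>R w s)"
    by (intro norm_triangle_mono norm_triangle_le_diff order_refl)
  also have "\<dots> \<le> \<epsilon>\<^sup>2 * (M * (t - s + 2 * \<epsilon>) + 2 * \<omega>)" using nI Js(2) Jt(2) by (simp add: algebra_simps)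
  finally have "norm (w t - w s) \<le> M * (t - s + 2 * \<epsilon>) + 2 * \<omega>" using \<epsilon>(1) by simp
  also have "\<dots> = M * (t - s) + (2 * M * \<epsilon> + 2 * \<omega>)" by (simp add: algebra_simps)
  also have "2 * M * \<epsilon> \<le> 2 * M * \<omega>" using \<epsilon> \<open>M \<ge> 0\<close> by (intro mult_left_mono) auto
  also have "2 * M * \<omega> + 2 * \<omega> = e"
  proof -
    have "2 * M * \<omega> + 2 * \<omega> = \<omega> * (2 + 2 * M)" by (simp add: algebra_simps)
    also have "\<dots> = e" using \<open>M \<ge> 0\<close> by (simp add: \<omega>_def)
    finally show ?thesis .
  qed
  finally show "norm (w t - w s) \<le> M * (t - s) + e" by simp
qed

text \<open>Test twice with \<open>\<psi>\<close> whose second derivative is the second difference of hats at \<open>t - h\<close>, \<open>t\<close>, \<open>t + h\<close>.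
Such a \<open>\<psi>\<close> has height at most \<open>2 * \<epsilon>\<^sup>2 * h\<close> and support of length \<open>2 * h + 2 * \<epsilon>\<close>, whence the bound of order
\<open>h\<^sup>2\<close>.\<close>

lemma weak_deriv2_second_difference:
  fixes w :: "real \<Rightarrow> 'a::banach"
  assumes cont: "continuous_on {0..} w" and wd: "weak_deriv w w'" "weak_deriv w' g" and "M \<ge> 0"
    and ae: "AE t in lebesgue. 0 < t \<and> t < T \<longrightarrow> norm (g t) \<le> M"
    and t: "0 < t - h" "t + h < T" and h: "h > 0"
  shows "norm (w (t + h) - 2 *\<^sub>R w t + w (t - h)) \<le> 4 * M * h\<^sup>2"
proof (rule field_le_epsilon)
  fix e :: real assume e: "e > 0"
  define \<omega> where "\<omega> = e / (4 + 4 * M * h)"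
  have Mh: "M * h \<ge> 0" using \<open>M \<ge> 0\<close> h by simp
  have \<omega>: "\<omega> > 0" using e Mh by (simp add: \<omega>_def add_pos_nonneg)
  obtain d1 where d1: "d1 > 0" "\<And>r. \<bar>r - (t - h)\<bar> \<le> d1 \<Longrightarrow> norm (w r - w (t - h)) \<le> \<omega>"
    using continuous_on_nonneg_close[OF cont _ \<omega>, of "t - h"] t by auto
  obtain d2 where d2: "d2 > 0" "\<And>r. \<bar>r - t\<bar> \<le> d2 \<Longrightarrow> norm (w r - w t) \<le> \<omega>"
    using continuous_on_nonneg_close[OF cont _ \<omega>, of t] t h by auto
  obtain d3 where d3: "d3 > 0" "\<And>r. \<bar>r - (t + h)\<bar> \<le> d3 \<Longrightarrow> norm (w r - w (t + h)) \<le> \<omega>"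
    using continuous_on_nonneg_close[OF cont _ \<omega>, of "t + h"] t h by auto
  \<comment> \<open>The first two bounds keep the support of the test function inside the interval.\<close>
  define \<epsilon> where "\<epsilon> = Min {t - h, T - (t + h), \<omega>, d1, d2, d3} / 2"
  have "0 < Min {t - h, T - (t + h), \<omega>, d1, d2, d3}" using t \<omega> d1(1) d2(1) d3(1) by simp
  then have "0 < \<epsilon>" "\<epsilon> < Min {t - h, T - (t + h), \<omega>, d1, d2, d3}" unfolding \<epsilon>_def by linarith+
  then have \<epsilon>: "0 < \<epsilon>" "\<epsilon> < t - h" "\<epsilon> < T - (t + h)" "\<epsilon> < \<omega>" "\<epsilon> < d1" "\<epsilon> < d2" "\<epsilon> < d3"
    by simp_all
  have cl: "norm (w r - w (t - h)) \<le> \<omega>" if "\<bar>r - (t - h)\<bar> \<le> \<epsilon>" for r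
    using that d1(2) \<epsilon> by simp
  have cl': "norm (w r - w t) \<le> \<omega>" if "\<bar>r - t\<bar> \<le> \<epsilon>" for r using that d2(2) \<epsilon> by simp
  have cl'': "norm (w r - w (t + h)) \<le> \<omega>" if "\<bar>r - (t + h)\<bar> \<le> \<epsilon>" for r
    using that d3(2) \<epsilon> by simp
  obtain Jm where Jm: "((\<lambda>r. hat \<epsilon> (r - (t - h)) *\<^sub>R w r) has_integral Jm) {0<..}"
    "norm (Jm - \<epsilon>\<^sup>2 *\<^sub>R w (t - h)) \<le> \<omega> * \<epsilon>\<^sup>2"
  proof (rule hat_average[OF \<epsilon>(1) _ cont, of "t - h"])
    show "t - h - \<epsilon> > 0" using \<epsilon> by simp
  qed (use cl in blast)
  obtain J where J: "((\<lambda>r. hat \<epsilon> (r - t) *\<^sub>R w r) has_integral J) {0<..}"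
    "norm (J - \<epsilon>\<^sup>2 *\<^sub>R w t) \<le> \<omega> * \<epsilon>\<^sup>2"
  proof (rule hat_average[OF \<epsilon>(1) _ cont, of t])
    show "t - \<epsilon> > 0" using \<epsilon> h by simp
  qed (use cl' in blast)
  obtain Jp where Jp: "((\<lambda>r. hat \<epsilon> (r - (t + h)) *\<^sub>R w r) has_integral Jp) {0<..}"
    "norm (Jp - \<epsilon>\<^sup>2 *\<^sub>R w (t + h)) \<le> \<omega> * \<epsilon>\<^sup>2"
  proof (rule hat_average[OF \<epsilon>(1) _ cont, of "t + h"])
    show "t + h - \<epsilon> > 0" using \<epsilon> h by simp
  qed (use cl'' in blast)
  define \<psi> where "\<psi> = (\<lambda>r. hat_primitive2 \<epsilon> (r - (t + h)) - 2 * hat_primitive2 \<epsilon> (r - t)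
    + hat_primitive2 \<epsilon> (r - (t - h)))"
  define \<psi>' where "\<psi>' = (\<lambda>r. hat_primitive \<epsilon> (r - (t + h)) - 2 * hat_primitive \<epsilon> (r - t)
    + hat_primitive \<epsilon> (r - (t - h)))"
  define \<psi>'' where "\<psi>'' = (\<lambda>r. hat \<epsilon> (r - (t + h)) - 2 * hat \<epsilon> (r - t) + hat \<epsilon> (r - (t - h)))"
  let ?a = "t - h - \<epsilon>" and ?b = "t + h + \<epsilon>"
  have supp: "\<psi> r = 0" "\<psi>' r = 0" if "r \<notin> {?a..?b}" for r
    using that \<epsilon> h
    by (cases "r < ?a"; auto simp: \<psi>_def \<psi>'_def hat_primitive2_left hat_primitive2_right
        hat_primitive_left hat_primitive_right algebra_simps)+
  have d2: "(\<psi>' has_real_derivative \<psi>'' r) (at r)" for r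
    unfolding \<psi>'_def \<psi>''_def by (intro DERIV_add DERIV_diff DERIV_cmult hat_primitive_derivative)
  have d1: "(\<psi> has_real_derivative \<psi>' r) (at r)" for r
    unfolding \<psi>_def \<psi>'_def by (intro DERIV_add DERIV_diff DERIV_cmult hat_primitive2_derivative)
  have ab: "0 < ?a" "?a \<le> ?b" using \<epsilon> h by auto
  have "continuous_on UNIV \<psi>''" unfolding \<psi>''_def by (intro continuous_intros)
  then have "test_fun \<psi>' \<psi>''" unfolding test_fun_def using d2 ab supp by blast
  then obtain I where I: "((\<lambda>r. \<psi>'' r *\<^sub>R w r) has_integral I) {0<..}"
    "((\<lambda>r. \<psi>' r *\<^sub>R w' r) has_integral - I) {0<..}"
    using wd(1) unfolding weak_deriv_def by blast
  have "continuous_on UNIV \<psi>'" using d2 by (intro DERIV_continuous_on) (auto intro: has_field_derivative_at_within)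
  then have "test_fun \<psi> \<psi>'" unfolding test_fun_def using d1 ab supp by blast
  then obtain I' where I': "((\<lambda>r. \<psi>' r *\<^sub>R w' r) has_integral I') {0<..}"
    "((\<lambda>r. \<psi> r *\<^sub>R g r) has_integral - I') {0<..}"
    using wd(2) unfolding weak_deriv_def by blast
  have "I' = - I" using I(2) I'(1) has_integral_unique by blast
  then have Ig: "((\<lambda>r. \<psi> r *\<^sub>R g r) has_integral I) {0<..}" using I'(2) by simp
  have "((\<lambda>r. hat \<epsilon> (r - (t + h)) *\<^sub>R w r - 2 *\<^sub>R (hat \<epsilon> (r - t) *\<^sub>R w r) + hat \<epsilon> (r - (t - h)) *\<^sub>R w r)
      has_integral (Jp - 2 *\<^sub>R J + Jm)) {0<..}"
    by (intro has_integral_add has_integral_diff has_integral_cmul Jm J Jp)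
  then have "((\<lambda>r. \<psi>'' r *\<^sub>R w r) has_integral (Jp - 2 *\<^sub>R J + Jm)) {0<..}"
    by (simp add: \<psi>''_def scaleR_left_distrib scaleR_diff_left)
  then have I_eq: "I = Jp - 2 *\<^sub>R J + Jm" using I(1) has_integral_unique by blast
  have "\<bar>\<psi> r\<bar> \<le> 2 * \<epsilon>\<^sup>2 * h" for r
    using hat_primitive2_lipschitz[OF \<epsilon>(1), of "r - (t + h)" "r - t"]
      hat_primitive2_lipschitz[OF \<epsilon>(1), of "r - (t - h)" "r - t"] h
    by (simp add: \<psi>_def abs_le_iff)
  then have "norm I \<le> 2 * \<epsilon>\<^sup>2 * h * M * (?b - ?a)"
    using \<epsilon> t supp ab by (intro norm_integral_test_fun_le[OF ae \<open>M \<ge> 0\<close> Ig]) auto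
  then have nI: "norm (Jp - 2 *\<^sub>R J + Jm) \<le> \<epsilon>\<^sup>2 * (4 * M * h\<^sup>2 + 4 * (M * h) * \<epsilon>)"
    unfolding I_eq by (simp add: algebra_simps power2_eq_square)
  have split: "norm (X - P + 2 *\<^sub>R Q - Z) \<le> norm X + norm P + 2 * norm Q + norm Z"
    for X P Q Z :: 'a by norm
  have "\<epsilon>\<^sup>2 * norm (w (t + h) - 2 *\<^sub>R w t + w (t - h))
      = norm (\<epsilon>\<^sup>2 *\<^sub>R (w (t + h) - 2 *\<^sub>R w t + w (t - h)))" by simp
  also have "\<dots> = norm ((Jp - 2 *\<^sub>R J + Jm) - (Jp - \<epsilon>\<^sup>2 *\<^sub>R w (t + h)) + 2 *\<^sub>R (J - \<epsilon>\<^sup>2 *\<^sub>R w t)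
      - (Jm - \<epsilon>\<^sup>2 *\<^sub>R w (t - h)))" by (simp add: algebra_simps)
  also have "\<dots> \<le> norm (Jp - 2 *\<^sub>R J + Jm) + norm (Jp - \<epsilon>\<^sup>2 *\<^sub>R w (t + h))
      + 2 * norm (J - \<epsilon>\<^sup>2 *\<^sub>R w t) + norm (Jm - \<epsilon>\<^sup>2 *\<^sub>R w (t - h))"
    by (rule split)
  also have "\<dots> \<le> \<epsilon>\<^sup>2 * (4 * M * h\<^sup>2 + 4 * (M * h) * \<epsilon> + 4 * \<omega>)"
    using nI J(2) Jm(2) Jp(2) by (simp add: algebra_simps)
  finally have "norm (w (t + h) - 2 *\<^sub>R w t + w (t - h)) \<le> 4 * M * h\<^sup>2 + (4 * (M * h) * \<epsilon> + 4 * \<omega>)"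
    using \<epsilon>(1) by (simp add: add.assoc)
  also have "4 * (M * h) * \<epsilon> \<le> 4 * (M * h) * \<omega>" using \<epsilon> Mh by (intro mult_left_mono) auto
  also have "4 * (M * h) * \<omega> + 4 * \<omega> = e"
  proof -
    have "4 * (M * h) * \<omega> + 4 * \<omega> = \<omega> * (4 + 4 * M * h)" by (simp add: algebra_simps)
    also have "\<dots> = e" using Mh by (simp add: \<omega>_def add_nonneg_eq_0_iff)
    finally show ?thesis .
  qed
  finally show "norm (w (t + h) - 2 *\<^sub>R w t + w (t - h)) \<le> 4 * M * h\<^sup>2 + e" by simp
qed

text \<open>The finite-difference counterpart of a bound in \<open>W\<^sup>2\<^sup>,\<^sup>\<infinity>(0, T)\<close>: values, Lipschitz constant and
second differences. Everything that the time discretization needs about \<open>u\<close> and \<open>q\<close> is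
expressed by it, and it is stable under products.\<close>

definition discrete_W2inf :: "real \<Rightarrow> real \<Rightarrow> (real \<Rightarrow> 'a::real_normed_vector) \<Rightarrow> bool" where
  "discrete_W2inf T M w \<longleftrightarrow>
     (\<forall>s\<in>{0..T}. norm (w s) \<le> M) \<and>
     (\<forall>s\<in>{0..T}. \<forall>t\<in>{0..T}. norm (w t - w s) \<le> M * \<bar>t - s\<bar>) \<and>
     (\<forall>t h. 0 \<le> h \<and> 0 \<le> t - h \<and> t + h \<le> T \<longrightarrow>
        norm (w (t + h) - 2 *\<^sub>R w t + w (t - h)) \<le> M * h\<^sup>2)"

text \<open>The weak-derivative estimates hold in the open half-line; continuity carries them to the end point 0.
The essential bounds are taken on the longer interval up to \<open>T + 1\<close> so that \<open>T\<close> itself is interior.\<close>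

lemma W2inf_loc_imp_discrete_W2inf:
  fixes w :: "real \<Rightarrow> 'a::banach"
  assumes cont: "continuous_on {0..} w" and reg: "W2inf_loc w" and T: "T > 0"
  shows "\<exists>M\<ge>0. discrete_W2inf T M w"
proof -
  obtain w' w'' where w: "Linf_loc w'" "Linf_loc w''" "weak_deriv w w'" "weak_deriv w' w''"
    using reg by (auto simp: W2inf_loc_def)
  obtain M1 where M1: "M1 \<ge> 0" "AE t in lebesgue. 0 < t \<and> t < T + 1 \<longrightarrow> norm (w' t) \<le> M1"
    using Linf_loc_bound[OF w(1)] by metis
  obtain M2 where M2: "M2 \<ge> 0" "AE t in lebesgue. 0 < t \<and> t < T + 1 \<longrightarrow> norm (w'' t) \<le> M2"
    using Linf_loc_bound[OF w(2)] by metis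
  have cT: "continuous_on {0..T} w" using cont by (rule continuous_on_subset) auto
  have "bounded (w ` {0..T})" by (intro compact_imp_bounded compact_continuous_image cT) simp
  then obtain M0 where M0: "M0 > 0" "\<And>s. s \<in> {0..T} \<Longrightarrow> norm (w s) \<le> M0"
    by (auto simp: bounded_pos)
  have lip: "norm (w t - w s) \<le> M1 * (t - s)" if "0 \<le> s" "s \<le> t" "t \<le> T" for s t
  proof (cases "s = t")
    case False
    with that have "s < t" by simp
    show ?thesis
    proof (rule tendsto_le[OF trivial_limit_at_right_real])
      have "continuous (at s within {s..t}) w"
        using continuous_on_subset[OF cT, of "{s..t}"] that
        by (auto simp: continuous_on_eq_continuous_within)
      then have ws: "(w \<longlongrightarrow> w s) (at_right s)"
        using \<open>s < t\<close> by (simp add: continuous_within at_within_Icc_at_right)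
      show "((\<lambda>r. norm (w t - w r)) \<longlongrightarrow> norm (w t - w s)) (at_right s)"
        by (intro tendsto_intros ws)
      show "((\<lambda>r. M1 * (t - r)) \<longlongrightarrow> M1 * (t - s)) (at_right s)"
        by (intro tendsto_intros)
      show "\<forall>\<^sub>F r in at_right s. norm (w t - w r) \<le> M1 * (t - r)"
        using that \<open>s < t\<close>
        by (intro eventually_at_rightI[of s t] weak_deriv_lipschitz[OF cont w(3) M1]) auto
    qed
  qed simp
  have sd: "norm (w (t + h) - 2 *\<^sub>R w t + w (t - h)) \<le> 4 * M2 * h\<^sup>2"
    if "0 \<le> h" "0 \<le> t - h" "t + h \<le> T" for t h
  proof (cases "h = 0")
    case True
    then show ?thesis by (simp add: scaleR_2)
  next
    case False
    with that have h: "h > 0" by simp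
    show ?thesis
    proof (rule tendsto_le[OF trivial_limit_at_left_real])
      have c: "continuous_on {0..h} (\<lambda>r. w (t + r) - 2 *\<^sub>R w t + w (t - r))"
        by (intro continuous_intros continuous_on_compose2[OF cT]) (use that in auto)
      then have "continuous (at h within {0..h}) (\<lambda>r. w (t + r) - 2 *\<^sub>R w t + w (t - r))"
        using h by (auto simp: continuous_on_eq_continuous_within)
      then show "((\<lambda>r. norm (w (t + r) - 2 *\<^sub>R w t + w (t - r))) \<longlongrightarrow>
          norm (w (t + h) - 2 *\<^sub>R w t + w (t - h))) (at_left h)"
        using h by (intro tendsto_norm) (simp add: continuous_within at_within_Icc_at_left)
      show "((\<lambda>r. 4 * M2 * r\<^sup>2) \<longlongrightarrow> 4 * M2 * h\<^sup>2) (at_left h)" by (intro tendsto_intros)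
      show "\<forall>\<^sub>F r in at_left h. norm (w (t + r) - 2 *\<^sub>R w t + w (t - r)) \<le> 4 * M2 * r\<^sup>2"
        using that h
        by (intro eventually_at_leftI[of 0 h] weak_deriv2_second_difference[OF cont w(3,4) M2]) auto
    qed
  qed
  define M where "M = max M0 (max M1 (4 * M2))"
  have M: "M0 \<le> M" "M1 \<le> M" "4 * M2 \<le> M" by (auto simp: M_def)
  have "norm (w t - w s) \<le> M * \<bar>t - s\<bar>" if "s \<in> {0..T}" "t \<in> {0..T}" for s t
  proof -
    have "norm (w t - w s) \<le> M1 * \<bar>t - s\<bar>"
      using lip[of s t] lip[of t s] that by (cases "s \<le> t") (auto simp: norm_minus_commute)
    also have "\<dots> \<le> M * \<bar>t - s\<bar>" using M by (intro mult_right_mono) auto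
    finally show ?thesis .
  qed
  moreover have "norm (w (t + h) - 2 *\<^sub>R w t + w (t - h)) \<le> M * h\<^sup>2"
    if "0 \<le> h" "0 \<le> t - h" "t + h \<le> T" for t h
    using sd[OF that] mult_right_mono[OF M(3), of "h\<^sup>2"] by simp
  moreover have "norm (w s) \<le> M" if "s \<in> {0..T}" for s using M0(2)[OF that] M by simp
  ultimately show ?thesis using M0(1) M by (intro exI[of _ M]) (auto simp: discrete_W2inf_def)
qed

section \<open>Second differences of the history integrand\<close>

lemma discrete_W2infD:
  assumes "discrete_W2inf T M w"
  shows "s \<in> {0..T} \<Longrightarrow> norm (w s) \<le> M"
    and "s \<in> {0..T} \<Longrightarrow> t \<in> {0..T} \<Longrightarrow> norm (w t - w s) \<le> M * \<bar>t - s\<bar>"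
    and "0 \<le> h \<Longrightarrow> 0 \<le> t - h \<Longrightarrow> t + h \<le> T \<Longrightarrow>
      norm (w (t + h) - 2 *\<^sub>R w t + w (t - h)) \<le> M * h\<^sup>2"
  using assms by (auto simp: discrete_W2inf_def)

text \<open>A discrete product rule: the second difference of \<open>Q w\<close> splits into two products of first
differences, the second difference of \<open>w\<close> under \<open>Q\<close>, and the second difference of \<open>Q\<close>
applied to \<open>w\<close>.\<close>

lemma discrete_W2inf_blinfun_apply:
  fixes Q :: "real \<Rightarrow> 'a::real_normed_vector \<Rightarrow>\<^sub>L 'b::real_normed_vector"
  assumes Q: "discrete_W2inf T B Q" and w: "discrete_W2inf T M w" and nonneg: "B \<ge> 0" "M \<ge> 0"
  shows "discrete_W2inf T (4 * B * M) (\<lambda>s. Q s (w s))"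
proof -
  have app: "norm (L x) \<le> b * m" if "norm L \<le> b" "norm x \<le> m"
    for L :: "'a \<Rightarrow>\<^sub>L 'b" and x b m
  proof -
    have "norm (L x) \<le> norm L * norm x" by (rule norm_blinfun)
    also have "\<dots> \<le> b * m" using that by (intro mult_mono) (auto intro: order_trans[OF norm_ge_zero])
    finally show ?thesis .
  qed
  have BM: "B * M \<ge> 0" using nonneg by simp
  note Qd = discrete_W2infD[OF Q] and wd = discrete_W2infD[OF w]
  show ?thesis
    unfolding discrete_W2inf_def
  proof (intro conjI ballI allI impI)
    fix s assume s: "s \<in> {0..T}"
    show "norm (Q s (w s)) \<le> 4 * B * M" using app[OF Qd(1)[OF s] wd(1)[OF s]] BM by simp
    fix t assume t: "t \<in> {0..T}"
    have "Q t (w t) - Q s (w s) = Q t (w t - w s) + (Q t - Q s) (w s)"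
      by (simp add: blinfun.diff_left blinfun.diff_right)
    also have "norm \<dots> \<le> B * (M * \<bar>t - s\<bar>) + (B * \<bar>t - s\<bar>) * M"
      by (intro norm_triangle_mono app Qd wd s t)
    also have "\<dots> = 2 * (B * M) * \<bar>t - s\<bar>" by simp
    also have "\<dots> \<le> 4 * (B * M) * \<bar>t - s\<bar>" using BM by (intro mult_right_mono) auto
    finally show "norm (Q t (w t) - Q s (w s)) \<le> 4 * B * M * \<bar>t - s\<bar>" by (simp add: mult.assoc)
  next
    fix t h :: real assume h: "0 \<le> h \<and> 0 \<le> t - h \<and> t + h \<le> T"
    then have mem: "t + h \<in> {0..T}" "t \<in> {0..T}" "t - h \<in> {0..T}" by auto
    have "Q (t + h) (w (t + h)) - 2 *\<^sub>R Q t (w t) + Q (t - h) (w (t - h))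
      = (Q (t + h) - Q t) (w (t + h) - w t) + (Q (t - h) - Q t) (w (t - h) - w t)
        + Q t (w (t + h) - 2 *\<^sub>R w t + w (t - h)) + (Q (t + h) - 2 *\<^sub>R Q t + Q (t - h)) (w t)"
      by (simp add: blinfun.bilinear_simps algebra_simps scaleR_2)
    moreover have "norm \<dots> \<le> (B * \<bar>t + h - t\<bar>) * (M * \<bar>t + h - t\<bar>)
        + (B * \<bar>t - h - t\<bar>) * (M * \<bar>t - h - t\<bar>) + B * (M * h\<^sup>2) + (B * h\<^sup>2) * M"
      using h by (intro norm_triangle_mono app Qd wd mem) auto
    moreover have "(B * \<bar>t + h - t\<bar>) * (M * \<bar>t + h - t\<bar>)
        + (B * \<bar>t - h - t\<bar>) * (M * \<bar>t - h - t\<bar>) + B * (M * h\<^sup>2) + (B * h\<^sup>2) * M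
      = 4 * B * M * h\<^sup>2"
    proof -
      have "\<bar>t + h - t\<bar> = h" "\<bar>t - h - t\<bar> = h" using h by auto
      then show ?thesis by (simp only: power2_eq_square) simp
    qed
    ultimately show "norm (Q (t + h) (w (t + h)) - 2 *\<^sub>R Q t (w t) + Q (t - h) (w (t - h)))
      \<le> 4 * B * M * h\<^sup>2" by (simp only:)
  qed
qed

lemma continuous_on_compact_norm_bound:
  fixes g :: "'a::topological_space \<Rightarrow> 'b::real_normed_vector"
  assumes "continuous_on S g" "compact S"
  shows "\<exists>B>0. \<forall>x\<in>S. norm (g x) \<le> B"
  using compact_imp_bounded[OF compact_continuous_image[OF assms]] by (auto simp: bounded_pos)

text \<open>The bound is uniform in the first argument because both derivatives are bounded on the compact square
\<open>{0..T} \<times> {0..T}\<close>; the quadrature error must not depend on the time level at which the history is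
evaluated.\<close>

lemma C2_on_imp_discrete_W2inf:
  fixes q :: "real \<times> real \<Rightarrow> 'a::real_normed_vector"
  assumes "C2_on ({0..} \<times> {0..}) q"
  shows "\<exists>B\<ge>0. \<forall>t\<in>{0..T}. discrete_W2inf T B (\<lambda>s. q (t, s))"
proof -
  let ?S = "{0..T} \<times> {0..T}"
  obtain g' g'' where
    d1: "\<And>p. p \<in> {0..} \<times> {0..} \<Longrightarrow> (q has_derivative blinfun_apply (g' p)) (at p within {0..} \<times> {0..})" and
    d2: "\<And>p. p \<in> {0..} \<times> {0..} \<Longrightarrow> (g' has_derivative blinfun_apply (g'' p)) (at p within {0..} \<times> {0..})" and
    c2: "continuous_on ({0..} \<times> {0..}) g''"
    using assms unfolding C2_on_def by blast
  have sub: "?S \<subseteq> {0..} \<times> {0..}" by auto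
  have D1: "(q has_derivative blinfun_apply (g' p)) (at p within ?S)" if "p \<in> ?S" for p
    using that sub by (intro has_derivative_subset[OF d1 sub]) auto
  have D2: "(g' has_derivative blinfun_apply (g'' p)) (at p within ?S)" if "p \<in> ?S" for p
    using that sub by (intro has_derivative_subset[OF d2 sub]) auto
  have comp: "compact ?S" by (intro compact_Times) auto
  have conv: "convex ?S" by (intro convex_Times) auto
  obtain B0 where B0: "B0 > 0" "\<And>p. p \<in> ?S \<Longrightarrow> norm (q p) \<le> B0"
    using continuous_on_compact_norm_bound[OF has_derivative_continuous_on[OF D1] comp] by blast
  obtain B1 where B1: "B1 > 0" "\<And>p. p \<in> ?S \<Longrightarrow> norm (g' p) \<le> B1"
    using continuous_on_compact_norm_bound[OF has_derivative_continuous_on[OF D2] comp] by blast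
  obtain B2 where B2: "B2 > 0" "\<And>p. p \<in> ?S \<Longrightarrow> norm (g'' p) \<le> B2"
    using continuous_on_compact_norm_bound[OF continuous_on_subset[OF c2 sub] comp] by blast
  have lip1: "norm (q x - q y) \<le> B1 * norm (x - y)" if "x \<in> ?S" "y \<in> ?S" for x y
    by (rule differentiable_bound[where f' = "\<lambda>p. blinfun_apply (g' p)", OF conv _ _ that])
      (use D1 B1(2) in \<open>simp_all add: norm_blinfun.rep_eq\<close>)
  have lip2: "norm (g' x - g' y) \<le> B2 * norm (x - y)" if "x \<in> ?S" "y \<in> ?S" for x y
    by (rule differentiable_bound[where f' = "\<lambda>p. blinfun_apply (g'' p)", OF conv _ _ that])
      (use D2 B2(2) in \<open>simp_all add: norm_blinfun.rep_eq\<close>)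
  define B where "B = max B0 (max B1 (2 * B2))"
  have B: "B0 \<le> B" "B1 \<le> B" "2 * B2 \<le> B" "B \<ge> 0" using B0 by (auto simp: B_def)
  have "discrete_W2inf T B (\<lambda>s. q (t, s))" if t: "t \<in> {0..T}" for t
    unfolding discrete_W2inf_def
  proof (intro conjI ballI allI impI)
    fix s assume s: "s \<in> {0..T}"
    show "norm (q (t, s)) \<le> B" using B0(2)[of "(t, s)"] s t B by simp
    fix s' assume s': "s' \<in> {0..T}"
    have "norm (q (t, s') - q (t, s)) \<le> B1 * \<bar>s' - s\<bar>"
      using lip1[of "(t, s')" "(t, s)"] s s' t by simp
    also have "\<dots> \<le> B * \<bar>s' - s\<bar>" using B by (intro mult_right_mono) auto
    finally show "norm (q (t, s') - q (t, s)) \<le> B * \<bar>s' - s\<bar>" .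
  next
    fix x h :: real assume h: "0 \<le> h \<and> 0 \<le> x - h \<and> x + h \<le> T"
    \<comment> \<open>The second difference is the increment over \<open>{0..h}\<close> of the even part, whose derivative is a difference of first derivatives.\<close>
    define F where "F = (\<lambda>r. q (t, x + r) + q (t, x - r))"
    define F' where "F' = (\<lambda>r d. g' (t, x + r) (0, d) + g' (t, x - r) (0, - d))"
    have dF: "(F has_derivative F' r) (at r within {0..h})" if r: "r \<in> {0..h}" for r
    proof -
      have *: "((\<lambda>r. (t, x + c * r)) has_derivative (\<lambda>d. (0, c * d))) (at r within {0..h})" for c
        by (rule derivative_eq_intros refl | simp)+
      have "((\<lambda>r. q (t, x + c * r)) has_derivative (\<lambda>d. g' (t, x + c * r) (0, c * d))) (at r within {0..h})"
        if "\<bar>c\<bar> = 1" for c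
      proof (rule has_derivative_in_compose2[OF D1 _ r *])
        show "(\<lambda>r. (t, x + c * r)) ` {0..h} \<subseteq> ?S" using that t h by (auto simp: abs_if split: if_splits)
      qed
      from this[of 1] this[of "-1"] show ?thesis
        unfolding F_def F'_def by (intro has_derivative_add) simp_all
    qed
    have "norm (F h - F 0) \<le> (2 * B2 * h) * norm (h - 0)"
    proof (rule differentiable_bound[where f' = F', OF _ dF])
      fix r assume r: "r \<in> {0..h}"
      show "onorm (F' r) \<le> 2 * B2 * h"
      proof (rule onorm_le)
        fix d
        have "F' r d = (g' (t, x + r) - g' (t, x - r)) (0, d)"
          using blinfun.minus_right[of "g' (t, x - r)" "(0, d)"] by (simp add: F'_def blinfun.diff_left)
        then have "norm (F' r d) \<le> norm (g' (t, x + r) - g' (t, x - r)) * norm d"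
          using norm_blinfun[of "g' (t, x + r) - g' (t, x - r)" "(0, d)"] by simp
        also have "norm (g' (t, x + r) - g' (t, x - r)) \<le> B2 * (2 * r)"
          using lip2[of "(t, x + r)" "(t, x - r)"] r h t by simp
        also have "\<dots> \<le> 2 * B2 * h" using r B2 by simp
        finally show "norm (F' r d) \<le> 2 * B2 * h * norm d" by (simp add: mult_right_mono)
      qed
    qed (use h in auto)
    then have "norm (F h - F 0) \<le> 2 * B2 * h\<^sup>2" using h by (simp add: power2_eq_square mult.assoc)
    also have "\<dots> \<le> B * h\<^sup>2" using B by (intro mult_right_mono) auto
    finally show "norm (q (t, x + h) - 2 *\<^sub>R q (t, x) + q (t, x - h)) \<le> B * h\<^sup>2"
      by (simp add: F_def scaleR_2 algebra_simps)
  qed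
  then show ?thesis using B by blast
qed

section \<open>Quadrature of the history integral\<close>

lemma discrete_W2inf_continuous_on:
  assumes "discrete_W2inf T M g" "M \<ge> 0"
  shows "continuous_on {0..T} g"
proof (rule lipschitz_on_continuous_on)
  show "M-lipschitz_on {0..T} g"
    using discrete_W2infD(2)[OF assms(1)] assms(2) by (intro lipschitz_onI) (auto simp: dist_norm)
qed

text \<open>Averaging \<open>g\<close> with its reflection in the midpoint leaves the integral unchanged. The averaged
integrand deviates from its value at the end points by two second differences centred at the
midpoint, which are of order \<open>k\<^sup>2\<close>.\<close>

lemma trapezoid_error:
  fixes g :: "real \<Rightarrow> 'a::banach"
  assumes g: "discrete_W2inf T M g" and M: "M \<ge> 0" and a: "0 \<le> a" "a + k \<le> T" "k \<ge> 0"
  shows "norm (integral {a..a + k} g - (k / 2) *\<^sub>R (g a + g (a + k))) \<le> M * k ^ 3"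
proof -
  let ?I = "{a..a + k}" and ?m = "a + k / 2"
  have cont: "continuous_on ?I g"
    using discrete_W2inf_continuous_on[OF g M] by (rule continuous_on_subset) (use a in auto)
  define J where "J = integral ?I g"
  have J: "(g has_integral J) ?I"
    unfolding J_def by (intro integrable_integral integrable_continuous_interval cont)
  \<comment> \<open>Reflection in the midpoint of the interval.\<close>
  have J': "((\<lambda>s. g (2 * ?m - s)) has_integral J) ?I"
  proof -
    have im: "(\<lambda>x. (2 * ?m) - x) ` ?I = ?I"
      by (simp add: image_diff_atLeastAtMost)
    show ?thesis
      using has_integral_affinity[of g J a "a + k" "-1" "2 * ?m"] J im by (simp add: add.commute)
  qed
  have "((\<lambda>s. (g s + g (2 * ?m - s)) - (g a + g (a + k))) has_integral ((J + J) - k *\<^sub>R (g a + g (a + k)))) ?I"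
    using has_integral_const_real[of "g a + g (a + k)" a "a + k"] a
    by (intro has_integral_diff has_integral_add J J') simp
  moreover have "((\<lambda>s. 2 * M * k\<^sup>2) has_integral (k * (2 * M * k\<^sup>2))) ?I"
    using has_integral_const_real[of "2 * M * k\<^sup>2" a "a + k"] a by simp
  moreover have "norm ((g s + g (2 * ?m - s)) - (g a + g (a + k))) \<le> 2 * M * k\<^sup>2" if s: "s \<in> ?I" for s
  proof -
    have near: "norm (g (?m + r) - 2 *\<^sub>R g ?m + g (?m - r)) \<le> M * k\<^sup>2"
      if r: "0 \<le> r" "r \<le> k / 2" for r
    proof -
      have "norm (g (?m + r) - 2 *\<^sub>R g ?m + g (?m - r)) \<le> M * r\<^sup>2"
        using r a by (intro discrete_W2infD(3)[OF g]) auto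
      also have "\<dots> \<le> M * k\<^sup>2" using r a M by (intro mult_left_mono power_mono) auto
      finally show ?thesis .
    qed
    have "norm (g s - 2 *\<^sub>R g ?m + g (2 * ?m - s)) \<le> M * k\<^sup>2"
    proof (cases "s \<ge> ?m")
      case True
      then show ?thesis using near[of "s - ?m"] s by (simp add: algebra_simps)
    next
      case False
      then show ?thesis using near[of "?m - s"] s by (simp add: algebra_simps)
    qed
    moreover have "norm (g (a + k) - 2 *\<^sub>R g ?m + g a) \<le> M * k\<^sup>2"
      using near[of "k / 2"] a by (simp add: add.commute)
    moreover have "(g s + g (2 * ?m - s)) - (g a + g (a + k))
        = (g s - 2 *\<^sub>R g ?m + g (2 * ?m - s)) - (g (a + k) - 2 *\<^sub>R g ?m + g a)" by simp
    ultimately show ?thesis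
      using norm_triangle_ineq4[of "g s - 2 *\<^sub>R g ?m + g (2 * ?m - s)" "g (a + k) - 2 *\<^sub>R g ?m + g a"]
      by (simp only:)
  qed
  ultimately have "norm ((J + J) - k *\<^sub>R (g a + g (a + k))) \<le> k * (2 * M * k\<^sup>2)"
    by (rule has_integral_norm_le)
  moreover have "(J + J) - k *\<^sub>R (g a + g (a + k)) = 2 *\<^sub>R (J - (k / 2) *\<^sub>R (g a + g (a + k)))"
    by (simp add: scaleR_2 scaleR_diff_right flip: scaleR_add_left)
  ultimately have "2 * norm (J - (k / 2) *\<^sub>R (g a + g (a + k))) \<le> k * (2 * M * k\<^sup>2)" by simp
  then show ?thesis by (simp add: J_def power2_eq_square power3_eq_cube ac_simps)
qed

lemma composite_trapezoid_error:
  fixes g :: "real \<Rightarrow> 'a::banach"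
  assumes g: "discrete_W2inf T M g" and M: "M \<ge> 0" and k: "k \<ge> 0"
  shows "real n * k \<le> T \<Longrightarrow>
    norm (integral {0..real n * k} g - (\<Sum>i<n. (k / 2) *\<^sub>R (g (real i * k) + g (real (Suc i) * k))))
    \<le> real n * (M * k ^ 3)"
proof (induction n)
  case 0
  then show ?case by simp
next
  case (Suc n)
  let ?a = "real n * k"
  have eq: "real (Suc n) * k = ?a + k" by (simp add: algebra_simps)
  have a: "0 \<le> ?a" "?a + k \<le> T" using k Suc.prems eq by auto
  have "continuous_on {0..?a + k} g"
    using discrete_W2inf_continuous_on[OF g M] by (rule continuous_on_subset) (use a in auto)
  then have "integral {0..?a + k} g = integral {0..?a} g + integral {?a..?a + k} g"
    using a k by (intro Henstock_Kurzweil_Integration.integral_combine[symmetric] integrable_continuous_interval) auto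
  then have "norm (integral {0..?a + k} g
      - (\<Sum>i<Suc n. (k / 2) *\<^sub>R (g (real i * k) + g (real (Suc i) * k))))
    = norm ((integral {0..?a} g - (\<Sum>i<n. (k / 2) *\<^sub>R (g (real i * k) + g (real (Suc i) * k))))
      + (integral {?a..?a + k} g - (k / 2) *\<^sub>R (g ?a + g (?a + k))))"
    using eq by (simp add: algebra_simps)
  also have "\<dots> \<le> real n * (M * k ^ 3) + M * k ^ 3"
    using a k by (intro norm_triangle_mono Suc.IH trapezoid_error[OF g M]) auto
  finally show ?case by (simp add: eq algebra_simps)
qed

text \<open>The rule behind \<open>disc_hist_op\<close>, separated from the operators: it uses the values of \<open>g\<close> at
\<open>0, k, \<dots>, (n - 1) * k\<close> only, so that the discrete history at level \<open>n\<close> is explicit.\<close>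

definition history_quadrature :: "real \<Rightarrow> (real \<Rightarrow> 'a::real_vector) \<Rightarrow> nat \<Rightarrow> 'a" where
  "history_quadrature k g n = (k / 2) *\<^sub>R g 0 + k *\<^sub>R (\<Sum>i = 1..<n. g (real i * k))
    + (k / 2) *\<^sub>R g (real (n - 1) * k)"

text \<open>The rule is the composite trapezoidal rule up to the previous time level plus one left
rectangle on the last step. The rectangle is only first order, but it is used on a single interval
and therefore costs \<open>k\<^sup>2\<close>, the same as the \<open>n - 1\<close> trapezoids together.\<close>

lemma history_quadrature_eq_trapezoid:
  "history_quadrature k g (Suc m) =
    (\<Sum>i<m. (k / 2) *\<^sub>R (g (real i * k) + g (real (Suc i) * k))) + k *\<^sub>R g (real m * k)"
proof (induction m)
  case 0
  then show ?case by (simp add: history_quadrature_def flip: scaleR_add_left)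
next
  case (Suc m)
  have half: "k *\<^sub>R x = (k / 2) *\<^sub>R x + (k / 2) *\<^sub>R x" for x :: 'a by (simp flip: scaleR_add_left)
  have "history_quadrature k g (Suc (Suc m)) = history_quadrature k g (Suc m)
      + (k *\<^sub>R g (real (Suc m) * k) + (k / 2) *\<^sub>R g (real (Suc m) * k) - (k / 2) *\<^sub>R g (real m * k))"
    by (simp add: history_quadrature_def scaleR_add_right)
  then show ?case unfolding Suc.IH by (simp add: scaleR_add_right half)
qed

lemma history_quadrature_error:
  fixes g :: "real \<Rightarrow> 'a::banach"
  assumes g: "discrete_W2inf T M g" and M: "M \<ge> 0" and k: "k \<ge> 0" and n: "n \<ge> 1" "real n * k \<le> T"
  shows "norm (integral {0..real n * k} g - history_quadrature k g n) \<le> M * (T + 1) * k\<^sup>2"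
proof -
  obtain m where m: "n = Suc m" using n by (cases n) auto
  let ?a = "real m * k"
  have eq: "real n * k = ?a + k" by (simp add: algebra_simps m)
  have a: "0 \<le> ?a" "?a + k \<le> T" "?a \<le> T" using k n eq by auto
  have cont: "continuous_on {0..?a + k} g"
    using discrete_W2inf_continuous_on[OF g M] by (rule continuous_on_subset) (use a in auto)
  have last: "norm (integral {?a..?a + k} g - k *\<^sub>R g ?a) \<le> M * k\<^sup>2"
  proof -
    have "((\<lambda>s. g s - g ?a) has_integral (integral {?a..?a + k} g - k *\<^sub>R g ?a)) {?a..?a + k}"
      using has_integral_const_real[of "g ?a" ?a "?a + k"] k a
      by (intro has_integral_diff integrable_integral integrable_continuous_interval
          continuous_on_subset[OF cont]) auto
    moreover have "((\<lambda>s. M * k) has_integral (k * (M * k))) {?a..?a + k}"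
      using has_integral_const_real[of "M * k" ?a "?a + k"] k by simp
    moreover have "norm (g s - g ?a) \<le> M * k" if "s \<in> {?a..?a + k}" for s
    proof -
      have "norm (g s - g ?a) \<le> M * \<bar>s - ?a\<bar>"
        using that a order_trans[OF a(1), of s] by (intro discrete_W2infD(2)[OF g]) auto
      also have "\<dots> \<le> M * k" using that M by (intro mult_left_mono) auto
      finally show ?thesis .
    qed
    ultimately have "norm (integral {?a..?a + k} g - k *\<^sub>R g ?a) \<le> k * (M * k)"
      by (rule has_integral_norm_le)
    then show ?thesis by (simp add: power2_eq_square algebra_simps)
  qed
  have "integral {0..?a + k} g = integral {0..?a} g + integral {?a..?a + k} g"
    using a k cont by (intro Henstock_Kurzweil_Integration.integral_combine[symmetric] integrable_continuous_interval) auto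
  then have "norm (integral {0..real n * k} g - history_quadrature k g n)
    = norm ((integral {0..?a} g - (\<Sum>i<m. (k / 2) *\<^sub>R (g (real i * k) + g (real (Suc i) * k))))
      + (integral {?a..?a + k} g - k *\<^sub>R g ?a))"
    unfolding eq by (simp add: m history_quadrature_eq_trapezoid algebra_simps)
  also have "\<dots> \<le> real m * (M * k ^ 3) + M * k\<^sup>2"
    using a by (intro norm_triangle_mono composite_trapezoid_error[OF g M k] last) auto
  also have "real m * (M * k ^ 3) = ?a * (M * k\<^sup>2)" by (simp add: power2_eq_square power3_eq_cube)
  also have "\<dots> \<le> T * (M * k\<^sup>2)" using a M by (intro mult_right_mono) auto
  finally show ?thesis by (simp add: algebra_simps)
qed

text \<open>The consistency error of the rule for the exact solution, plus the propagated errors of earlier time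
levels. Every weight of the rule is at most \<open>2 * k\<close>, including \<open>n = 1\<close>, where both end weights
\<open>k / 2\<close> meet at the point 0.\<close>

lemma history_operator_error:
  fixes q :: "real \<times> real \<Rightarrow> 'x::banach \<Rightarrow>\<^sub>L 'x" and R :: "'x \<Rightarrow>\<^sub>L 'y::real_normed_vector"
  assumes q: "discrete_W2inf T B (\<lambda>s. q (real n * k, s))" and u: "discrete_W2inf T M u"
    and nonneg: "B \<ge> 0" "M \<ge> 0" "k \<ge> 0" "T \<ge> 0" and n: "real n * k \<le> T"
  shows "norm (hist_op R q a u (real n * k) - disc_hist_op R q a k w n)
    \<le> norm R * (4 * B * M * (T + 1) * k\<^sup>2 + 2 * B * (k * (\<Sum>i<n. norm (u (real i * k) - w i))))"
proof (cases "n = 0")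
  case True
  then show ?thesis using nonneg by (simp add: hist_op_def disc_hist_op_def)
next
  case False
  then have n1: "n \<ge> 1" by simp
  define t where "t = real n * k"
  define g where "g = (\<lambda>s. q (t, s) (u s))"
  define e where "e = (\<lambda>i. u (real i * k) - w i)"
  let ?S = "\<Sum>i<n. norm (e i)"
  let ?E = "(k / 2) *\<^sub>R q (t, 0) (e 0) + k *\<^sub>R (\<Sum>i = 1..<n. q (t, real i * k) (e i))
      + (k / 2) *\<^sub>R q (t, real (n - 1) * k) (e (n - 1))"
  have gd: "discrete_W2inf T (4 * B * M) g"
    unfolding g_def t_def by (intro discrete_W2inf_blinfun_apply q u nonneg)
  have qe: "norm (q (t, real i * k) (e i)) \<le> B * norm (e i)" if "i < n" for i
  proof -
    have "real i * k \<le> real n * k" using that nonneg by (intro mult_right_mono) auto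
    then have "real i * k \<in> {0..T}" using n nonneg by auto
    then have "norm (q (t, real i * k)) \<le> B" unfolding t_def using discrete_W2infD(1)[OF q] by blast
    then have "norm (q (t, real i * k)) * norm (e i) \<le> B * norm (e i)" by (intro mult_right_mono) auto
    then show ?thesis using norm_blinfun[of "q (t, real i * k)" "e i"] by linarith
  qed
  have qe': "norm (q (t, real i * k) (e i)) \<le> B * ?S" if "i < n" for i
  proof -
    have "norm (e i) \<le> ?S" using that by (intro member_le_sum) auto
    then have "B * norm (e i) \<le> B * ?S" using nonneg by (intro mult_left_mono)
    then show ?thesis using qe[OF that] by linarith
  qed
  have "norm (\<Sum>i = 1..<n. q (t, real i * k) (e i)) \<le> (\<Sum>i = 1..<n. B * norm (e i))"
    by (rule sum_norm_le) (use qe in auto)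
  also have "\<dots> \<le> (\<Sum>i<n. B * norm (e i))" using nonneg by (intro sum_mono2) auto
  also have "\<dots> = B * ?S" by (simp add: sum_distrib_left)
  finally have mid: "norm (\<Sum>i = 1..<n. q (t, real i * k) (e i)) \<le> B * ?S" .
  have "norm ?E \<le> k / 2 * (B * ?S) + k * (B * ?S) + k / 2 * (B * ?S)"
    using nonneg mid qe'[of 0] qe'[of "n - 1"] n1
    by (intro norm_triangle_mono) (auto intro!: mult_left_mono)
  then have E: "norm ?E \<le> 2 * B * (k * ?S)" by (simp add: algebra_simps)
  have "hist_op R q a u t - disc_hist_op R q a k w n
      = R ((integral {0..t} g - history_quadrature k g n) + ?E)"
    using False by (simp add: hist_op_def disc_hist_op_def Let_def history_quadrature_def g_def t_def e_def
        blinfun.diff_right blinfun.add_right blinfun.minus_right sum_subtractf scaleR_diff_right)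
  also have "norm \<dots> \<le> norm R * norm ((integral {0..t} g - history_quadrature k g n) + ?E)"
    by (rule norm_blinfun)
  also have "\<dots> \<le> norm R * (4 * B * M * (T + 1) * k\<^sup>2 + 2 * B * (k * ?S))"
  proof (intro mult_left_mono norm_triangle_mono E)
    show "norm (integral {0..t} g - history_quadrature k g n) \<le> 4 * B * M * (T + 1) * k\<^sup>2"
      unfolding t_def using nonneg n n1 by (intro history_quadrature_error[OF gd]) auto
  qed simp
  finally show ?thesis by (simp add: t_def e_def)
qed

section \<open>The energy inequality for the error\<close>

text \<open>Strong monotonicity is combined with the continuous inequality tested by the discrete solution \<open>w\<close> and
the discrete inequality tested by \<open>v\<close>. What remains of the terms at \<open>u\<close> is the residual of \<open>v\<close>.
The Clarke derivative at \<open>\<gamma> w\<close> is split by subadditivity into a direction towards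
\<open>\<gamma> u\<close>, which the relaxed monotonicity absorbs, and the direction \<open>\<gamma> v - \<gamma> u\<close>. The growth bound for the
latter contains \<open>norm (\<gamma> w)\<close>, which is estimated by \<open>norm (\<gamma> u)\<close> and the error itself; the
resulting product of two errors is quadratic and can be absorbed later. The point \<open>\<theta>\<close> is the argument at which \<open>\<phi>\<close> is
frozen and \<open>J\<close> stands for the stabilization terms; both are specialised for the starting steps
(\<open>\<theta> = w\<close>, \<open>J = 0\<close>) and for the extrapolated steps.\<close>

lemma vhi_energy_inequality:
  fixes K D :: "'x::banach set" and \<gamma> :: "'x \<Rightarrow>\<^sub>L 'z::banach" and A :: "'x \<Rightarrow> 'x \<Rightarrow>\<^sub>L real"
    and \<phi> :: "'y::real_normed_vector \<Rightarrow> 'x \<Rightarrow> 'x \<Rightarrow> real" and l :: "'x \<Rightarrow>\<^sub>L real"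
  assumes monotone: "m * (norm (u - w))\<^sup>2 \<le> (A u - A w) (u - w)"
    and lipschitz: "norm (A u - A w) \<le> L * norm (u - w)"
    and \<phi>: "\<phi> y u w - \<phi> y u v + \<phi> y' \<theta> v - \<phi> y' \<theta> w
      \<le> \<alpha>\<^sub>\<phi> * norm (u - \<theta>) * norm (v - w) + \<beta>\<^sub>\<phi> * norm (y - y') * norm (v - w)"
    and nonneg: "\<alpha>\<^sub>\<phi> \<ge> 0" "\<beta>\<^sub>\<phi> \<ge> 0" "c1 \<ge> 0"
    and \<gamma>: "\<And>x. norm (\<gamma> x) \<le> c\<^sub>j * norm x"
    and j: "loc_lipschitz j"
    and growth: "\<And>z x. \<bar>clarke_deriv j z x\<bar> \<le> (c0 + c1 * norm z) * norm x"
    and relaxed: "\<And>z1 z2. clarke_deriv j z1 (z2 - z1) + clarke_deriv j z2 (z1 - z2)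
      \<le> \<alpha>\<^sub>j * (norm (z1 - z2))\<^sup>2"
    and continuous: "A u (w - u) + \<phi> y u w - \<phi> y u u + clarke_deriv j (\<gamma> u) (\<gamma> w - \<gamma> u) \<ge> l (w - u)"
    and discrete: "A w (v - w) + \<phi> y' \<theta> v - \<phi> y' \<theta> w + clarke_deriv j (\<gamma> w) (\<gamma> v - \<gamma> w) + J \<ge> l (v - w)"
    and G: "norm (\<gamma> u) \<le> G"
  shows "m * (norm (u - w))\<^sup>2 \<le> \<alpha>\<^sub>\<phi> * norm (u - \<theta>) * (norm (u - w) + norm (u - v))
    + \<beta>\<^sub>\<phi> * norm (y - y') * (norm (u - w) + norm (u - v))
    + L * norm (u - w) * norm (u - v)
    + (2 * c0 + 2 * c1 * G + c1 * c\<^sub>j * norm (u - w)) * norm (\<gamma> u - \<gamma> v)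
    + \<bar>vhi_residual A \<phi> j \<gamma> y l v u\<bar> + \<alpha>\<^sub>j * (norm (\<gamma> u - \<gamma> w))\<^sup>2 + J"
proof -
  let ?e = "norm (u - w)" and ?d = "norm (u - v)" and ?d' = "norm (\<gamma> u - \<gamma> v)"
  let ?vw = "norm (v - w)"
  have vw: "?vw \<le> ?e + ?d" using norm_triangle_ineq[of "v - u" "u - w"] by (simp add: norm_minus_commute)
  have split_A: "(A u - A w) (u - w) = A u (v - u) - A u (w - u) - A w (v - w) - (A u - A w) (v - u)"
    by (simp add: blinfun.bilinear_simps)
  have split_l: "l (v - u) = l (w - u) + l (v - w)" by (simp add: blinfun.bilinear_simps)
  have "\<bar>(A u - A w) (v - u)\<bar> \<le> norm (A u - A w) * norm (v - u)"
    using norm_blinfun[of "A u - A w" "v - u"] by simp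
  also have "\<dots> \<le> L * ?e * ?d"
    using lipschitz by (simp add: norm_minus_commute mult_right_mono)
  finally have lip: "- (A u - A w) (v - u) \<le> L * ?e * ?d" by simp
  have "clarke_deriv j (\<gamma> w) (\<gamma> v - \<gamma> w)
      \<le> clarke_deriv j (\<gamma> w) (\<gamma> u - \<gamma> w) + clarke_deriv j (\<gamma> w) (\<gamma> v - \<gamma> u)"
    using clarke_deriv_subadditive[OF j, of "\<gamma> w" "\<gamma> u - \<gamma> w" "\<gamma> v - \<gamma> u"] by simp
  moreover have "clarke_deriv j (\<gamma> u) (\<gamma> w - \<gamma> u) + clarke_deriv j (\<gamma> w) (\<gamma> u - \<gamma> w)
      \<le> \<alpha>\<^sub>j * (norm (\<gamma> u - \<gamma> w))\<^sup>2" by (rule relaxed)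
  moreover have "clarke_deriv j (\<gamma> w) (\<gamma> v - \<gamma> u) \<le> (c0 + c1 * (G + c\<^sub>j * ?e)) * ?d'"
  proof -
    have "norm (\<gamma> w) \<le> norm (\<gamma> u) + norm (\<gamma> (w - u))"
      using norm_triangle_ineq[of "\<gamma> u" "\<gamma> w - \<gamma> u"] by (simp add: blinfun.diff_right)
    also have "\<dots> \<le> G + c\<^sub>j * ?e" using G \<gamma>[of "w - u"] by (simp add: norm_minus_commute)
    finally have "(c0 + c1 * norm (\<gamma> w)) * ?d' \<le> (c0 + c1 * (G + c\<^sub>j * ?e)) * ?d'"
      using nonneg by (intro mult_right_mono add_left_mono mult_left_mono) auto
    then show ?thesis using growth[of "\<gamma> w" "\<gamma> v - \<gamma> u"] by (simp add: norm_minus_commute)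
  qed
  moreover have "- clarke_deriv j (\<gamma> u) (\<gamma> v - \<gamma> u) \<le> (c0 + c1 * G) * ?d'"
  proof -
    have "(c0 + c1 * norm (\<gamma> u)) * ?d' \<le> (c0 + c1 * G) * ?d'"
      using nonneg G by (intro mult_right_mono add_left_mono mult_left_mono) auto
    then show ?thesis using growth[of "\<gamma> u" "\<gamma> v - \<gamma> u"] by (simp add: norm_minus_commute)
  qed
  ultimately have clarke: "clarke_deriv j (\<gamma> u) (\<gamma> w - \<gamma> u) + clarke_deriv j (\<gamma> w) (\<gamma> v - \<gamma> w)
      - clarke_deriv j (\<gamma> u) (\<gamma> v - \<gamma> u)
      \<le> \<alpha>\<^sub>j * (norm (\<gamma> u - \<gamma> w))\<^sup>2 + (2 * c0 + 2 * c1 * G + c1 * c\<^sub>j * ?e) * ?d'"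
    by (simp add: algebra_simps)
  have "\<alpha>\<^sub>\<phi> * norm (u - \<theta>) * ?vw \<le> \<alpha>\<^sub>\<phi> * norm (u - \<theta>) * (?e + ?d)"
    "\<beta>\<^sub>\<phi> * norm (y - y') * ?vw \<le> \<beta>\<^sub>\<phi> * norm (y - y') * (?e + ?d)"
    using vw nonneg by (auto intro!: mult_left_mono)
  then show ?thesis
    using monotone lip clarke \<phi> continuous discrete abs_ge_self[of "vhi_residual A \<phi> j \<gamma> y l v u"]
    unfolding split_A split_l vhi_residual_def by linarith
qed

text \<open>Here \<open>\<theta>\<close> is the extrapolated value. Writing \<open>w - \<theta> = (w - u) + (u - \<theta>)\<close> produces
\<open>- jc (\<gamma> (u - w)) (\<gamma> (u - w))\<close>, and the coercivity of \<open>jc\<close> cancels the nonconvexity term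
\<open>\<alpha>\<^sub>j * (norm (\<gamma> u - \<gamma> w))\<^sup>2\<close>. All other terms carry an extrapolation or approximation error. Hence
\<open>\<alpha>\<^sub>c\<close> takes the place of \<open>\<alpha>\<^sub>j\<close> in the smallness condition for these steps.\<close>

lemma extrapolated_stabilization_bound:
  fixes \<gamma> :: "'x::real_normed_vector \<Rightarrow>\<^sub>L 'z::real_normed_vector" and jc :: "'z \<Rightarrow> 'z \<Rightarrow>\<^sub>L real"
  assumes "linear jc" "\<alpha>\<^sub>c \<ge> 0" "\<And>z. norm (jc z) \<le> \<alpha>\<^sub>c * norm z" "\<And>z. jc z z \<ge> \<alpha>\<^sub>j * (norm z)\<^sup>2"
    and \<gamma>: "c\<^sub>j \<ge> 0" "\<And>x. norm (\<gamma> x) \<le> c\<^sub>j * norm x"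
  shows "jc (\<gamma> w) (\<gamma> v - \<gamma> w) - jc (\<gamma> \<theta>) (\<gamma> v - \<gamma> w) + \<alpha>\<^sub>j * (norm (\<gamma> u - \<gamma> w))\<^sup>2
    \<le> \<alpha>\<^sub>c * c\<^sub>j\<^sup>2 * (norm (u - \<theta>) * (norm (u - w) + norm (u - v)) + norm (u - w) * norm (u - v))"
proof -
  interpret jc: linear jc by fact
  have bound: "jc (\<gamma> x) (\<gamma> x') \<le> \<alpha>\<^sub>c * c\<^sub>j\<^sup>2 * (norm x * norm x')" for x x'
  proof -
    have "jc (\<gamma> x) (\<gamma> x') \<le> norm (jc (\<gamma> x)) * norm (\<gamma> x')"
      using norm_blinfun[of "jc (\<gamma> x)" "\<gamma> x'"] by simp
    also have "\<dots> \<le> (\<alpha>\<^sub>c * (c\<^sub>j * norm x)) * (c\<^sub>j * norm x')"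
      using assms by (intro mult_mono order_trans[OF assms(3)] mult_left_mono) auto
    finally show ?thesis by (simp add: power2_eq_square algebra_simps)
  qed
  have "jc (\<gamma> w) (\<gamma> v - \<gamma> w) - jc (\<gamma> \<theta>) (\<gamma> v - \<gamma> w) + jc (\<gamma> u - \<gamma> w) (\<gamma> u - \<gamma> w)
    = jc (\<gamma> (w - u)) (\<gamma> (v - u)) + jc (\<gamma> (u - \<theta>)) (\<gamma> (v - u)) + jc (\<gamma> (u - \<theta>)) (\<gamma> (u - w))"
    by (simp add: jc.diff blinfun.bilinear_simps)
  also have "\<dots> \<le> \<alpha>\<^sub>c * c\<^sub>j\<^sup>2 * (norm (w - u) * norm (v - u)) + \<alpha>\<^sub>c * c\<^sub>j\<^sup>2 * (norm (u - \<theta>) * norm (v - u))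
    + \<alpha>\<^sub>c * c\<^sub>j\<^sup>2 * (norm (u - \<theta>) * norm (u - w))"
    by (intro add_mono bound)
  finally show ?thesis using assms(4)[of "\<gamma> u - \<gamma> w"]
    by (simp add: algebra_simps norm_minus_commute)
qed

section \<open>Error recursion and discrete Gronwall inequality\<close>

lemma quadratic_le_imp_le:
  fixes e :: real
  assumes "m > 0" "b \<ge> 0" "c \<ge> 0" "e \<ge> 0" and le: "m * e\<^sup>2 \<le> b * e + c"
  shows "e \<le> b / m + sqrt (c / m)"
proof (rule ccontr)
  let ?s = "sqrt (c / m)"
  assume "\<not> e \<le> b / m + ?s"
  then have gt: "e > b / m + ?s" by simp
  have s: "?s \<ge> 0" "?s * ?s = c / m" using assms by auto
  have bm: "b / m \<ge> 0" using assms by simp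
  have "?s * ?s \<le> (e - b / m) * ?s" using gt s by (intro mult_right_mono) auto
  also have "\<dots> < (e - b / m) * e"
  proof (rule mult_strict_left_mono)
    show "?s < e" "0 < e - b / m"
      using gt s(1) bm \<open>e \<ge> 0\<close> by linarith+
  qed
  finally have "c / m < (e - b / m) * e" using s by simp
  then have "c < m * ((e - b / m) * e)" using \<open>m > 0\<close> by (simp add: pos_divide_less_eq mult.commute)
  also have "\<dots> = m * e\<^sup>2 - b * e" using \<open>m > 0\<close> by (simp add: field_simps power2_eq_square)
  finally show False using le by simp
qed

lemma sqrt_mult_le_weighted:
  assumes "x \<ge> 0" "y \<ge> 0" "\<epsilon> > 0"
  shows "sqrt (x * y) \<le> \<epsilon> * x + y / (4 * \<epsilon>)"
proof (rule real_le_lsqrt)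
  have "4 * (\<epsilon> * x) * (y / (4 * \<epsilon>)) = x * y" using assms by simp
  moreover have "4 * (\<epsilon> * x) * (y / (4 * \<epsilon>)) \<le> (\<epsilon> * x + y / (4 * \<epsilon>))\<^sup>2"
    using zero_le_power2[of "\<epsilon> * x - y / (4 * \<epsilon>)"] unfolding power2_sum power2_diff by linarith
  ultimately show "x * y \<le> (\<epsilon> * x + y / (4 * \<epsilon>))\<^sup>2" by simp
qed (use assms in auto)

lemma sqrt_add4_le:
  assumes "a \<ge> 0" "b \<ge> 0" "c \<ge> 0" "d \<ge> 0"
  shows "sqrt (a + b + c + d) \<le> sqrt a + sqrt b + sqrt c + sqrt d"
  using sqrt_add_le_add_sqrt[of "a + b + c" d] sqrt_add_le_add_sqrt[of "a + b" c]
    sqrt_add_le_add_sqrt[of a b] assms by simp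

text \<open>In the applications \<open>e\<close> is the error, \<open>X\<close> the extrapolation error, \<open>Y\<close> the history error, \<open>d\<close> and \<open>d'\<close>
the approximation errors in the two spaces and \<open>E\<close> the residual. The factor of \<open>X\<close> has to stay below
\<open>1 / 3\<close>, so the mixed term \<open>X * d\<close> is split with a weight \<open>\<epsilon>\<close> at the expense of \<open>C\<close>; the other
factors may be large.\<close>

lemma error_from_energy_inequality:
  fixes m \<kappa> \<beta> L c \<epsilon> :: real
  assumes m: "m > 0" and nonneg: "\<kappa> \<ge> 0" "\<beta> \<ge> 0" "L \<ge> 0" "c \<ge> 0" and \<epsilon>: "\<epsilon> > 0"
  shows "\<exists>C\<ge>0. \<forall>e X Y d d' E. 0 \<le> e \<longrightarrow> 0 \<le> X \<longrightarrow> 0 \<le> Y \<longrightarrow> 0 \<le> d \<longrightarrow> 0 \<le> d' \<longrightarrow> 0 \<le> E \<longrightarrow>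
    m * e\<^sup>2 \<le> \<kappa> * X * (e + d) + \<beta> * Y * (e + d) + L * e * d + c * d' + E \<longrightarrow>
    e \<le> (\<kappa> / m + \<epsilon>) * X + C * Y + C * (d + sqrt d' + sqrt E)"
proof -
  define C where "C = \<beta> / m + 1 + L / m + \<kappa> / m / (4 * \<epsilon>) + \<beta> / m / 4 + sqrt (c / m) + sqrt (1 / m)"
  have parts: "\<beta> / m \<ge> 0" "L / m \<ge> 0" "\<kappa> / m / (4 * \<epsilon>) \<ge> 0" "\<beta> / m / 4 \<ge> 0" "sqrt (c / m) \<ge> 0" "sqrt (1 / m) \<ge> 0"
    using m nonneg \<epsilon> by simp_all
  have C: "\<beta> / m + 1 \<le> C" "L / m + \<kappa> / m / (4 * \<epsilon>) + \<beta> / m / 4 \<le> C" "sqrt (c / m) \<le> C" "sqrt (1 / m) \<le> C" "C \<ge> 0"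
    using parts by (simp_all add: C_def del: real_sqrt_divide real_sqrt_le_iff real_sqrt_ge_0_iff)
  have "e \<le> (\<kappa> / m + \<epsilon>) * X + C * Y + C * (d + sqrt d' + sqrt E)"
    if nn: "0 \<le> e" "0 \<le> X" "0 \<le> Y" "0 \<le> d" "0 \<le> d'" "0 \<le> E"
      and le: "m * e\<^sup>2 \<le> \<kappa> * X * (e + d) + \<beta> * Y * (e + d) + L * e * d + c * d' + E"
    for e X Y d d' E
  proof -
    have b: "\<kappa> * X + \<beta> * Y + L * d \<ge> 0" and c': "\<kappa> * X * d + \<beta> * Y * d + c * d' + E \<ge> 0"
      using nn nonneg by auto
    have "e \<le> (\<kappa> * X + \<beta> * Y + L * d) / m + sqrt ((\<kappa> * X * d + \<beta> * Y * d + c * d' + E) / m)"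
      using le by (intro quadratic_le_imp_le m b c' nn) (simp add: algebra_simps)
    also have "(\<kappa> * X * d + \<beta> * Y * d + c * d' + E) / m
        = X * (\<kappa> / m * d) + Y * (\<beta> / m * d) + c / m * d' + 1 / m * E"
      by (simp add: add_divide_distrib ac_simps)
    also have "sqrt \<dots> \<le> sqrt (X * (\<kappa> / m * d)) + sqrt (Y * (\<beta> / m * d)) + sqrt (c / m * d') + sqrt (1 / m * E)"
      using nn nonneg m by (intro sqrt_add4_le) auto
    also have "sqrt (X * (\<kappa> / m * d)) \<le> \<epsilon> * X + \<kappa> / m * d / (4 * \<epsilon>)"
      using nn nonneg m \<epsilon> by (intro sqrt_mult_le_weighted) auto
    also have "sqrt (Y * (\<beta> / m * d)) \<le> 1 * Y + \<beta> / m * d / (4 * 1)"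
      using nn nonneg m by (intro sqrt_mult_le_weighted) auto
    also have "sqrt (c / m * d') \<le> C * sqrt d'"
      unfolding real_sqrt_mult using C nn by (intro mult_right_mono) auto
    also have "sqrt (1 / m * E) \<le> C * sqrt E"
      unfolding real_sqrt_mult using C nn by (intro mult_right_mono) auto
    finally have "e \<le> (\<kappa> / m + \<epsilon>) * X + (\<beta> / m + 1) * Y + (L / m + \<kappa> / m / (4 * \<epsilon>) + \<beta> / m / 4) * d
        + C * sqrt d' + C * sqrt E"
      by (simp add: algebra_simps add_divide_distrib)
    also have "\<dots> \<le> (\<kappa> / m + \<epsilon>) * X + C * Y + C * d + C * sqrt d' + C * sqrt E"
      using C nn by (intro add_mono mult_right_mono order_refl) auto
    finally show ?thesis by (simp add: algebra_simps)
  qed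
  then show ?thesis using C(5) by blast
qed

text \<open>The extrapolation contributes a multiple \<open>\<rho> < 1\<close> of the largest earlier error and the history a sum with
the small factor \<open>k\<close>. With \<open>b = C / (1 - \<rho>)\<close> the sequence \<open>b * \<eta> * (1 + b * k) ^ n\<close> turns both contributions
into an exact equality, so it dominates by induction; and it stays bounded while
\<open>N * k\<close> does.\<close>

lemma discrete_gronwall_contraction:
  fixes e :: "nat \<Rightarrow> real"
  assumes \<rho>: "0 \<le> \<rho>" "\<rho> < 1" and C: "C \<ge> 0" "k > 0" "\<eta> \<ge> 0"
    and step: "\<And>n P. n \<le> N \<Longrightarrow> 0 \<le> P \<Longrightarrow> (\<And>i. i < n \<Longrightarrow> e i \<le> P) \<Longrightarrow>
      e n \<le> \<rho> * P + C * \<eta> + C * (k * (\<Sum>i<n. e i))"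
    and n: "n \<le> N"
  shows "e n \<le> C / (1 - \<rho>) * exp (C / (1 - \<rho>) * (real N * k)) * \<eta>"
proof -
  define b where "b = C / (1 - \<rho>)"
  define x where "x = 1 + b * k"
  have b: "b \<ge> 0" "C = (1 - \<rho>) * b" using \<rho> C by (auto simp: b_def)
  have x: "x \<ge> 1" using b C by (simp add: x_def)
  have geo: "b * (k * (\<Sum>i<n. x ^ i)) = x ^ n - 1" for n
    by (induction n) (simp_all add: x_def algebra_simps)
  have "n \<le> N \<longrightarrow> e n \<le> b * \<eta> * x ^ n"
  proof (induction n rule: less_induct)
    case (less n)
    show ?case
    proof
      assume n: "n \<le> N"
      have IH: "e i \<le> b * \<eta> * x ^ i" if "i < n" for i using less.IH[OF that] that n by simp
      have "(\<Sum>i<n. e i) \<le> (\<Sum>i<n. b * \<eta> * x ^ i)" using IH by (intro sum_mono) auto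
      then have "k * (\<Sum>i<n. e i) \<le> k * (\<Sum>i<n. b * \<eta> * x ^ i)" using C by (intro mult_left_mono) auto
      also have "\<dots> = \<eta> * (b * (k * (\<Sum>i<n. x ^ i)))"
        by (simp add: sum_distrib_left[symmetric])
      also have "\<dots> = \<eta> * (x ^ n - 1)" by (simp add: geo)
      finally have S: "C * (k * (\<Sum>i<n. e i)) \<le> C * (\<eta> * (x ^ n - 1))" using C by (intro mult_left_mono)
      have "e n \<le> \<rho> * (b * \<eta> * x ^ n) + C * \<eta> + C * (k * (\<Sum>i<n. e i))"
      proof (rule step[OF n])
        show "0 \<le> b * \<eta> * x ^ n" using b C x by simp
        fix i assume i: "i < n"
        have "e i \<le> b * \<eta> * x ^ i" by (rule IH[OF i])
        also have "\<dots> \<le> b * \<eta> * x ^ n"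
          using x i b C by (intro mult_left_mono power_increasing) auto
        finally show "e i \<le> b * \<eta> * x ^ n" .
      qed
      also have "\<dots> \<le> \<rho> * (b * \<eta> * x ^ n) + C * \<eta> + C * (\<eta> * (x ^ n - 1))" using S by simp
      also have "\<dots> = b * \<eta> * x ^ n" unfolding b(2) by (simp add: algebra_simps)
      finally show "e n \<le> b * \<eta> * x ^ n" .
    qed
  qed
  then have "e n \<le> b * \<eta> * x ^ n" using n by simp
  also have "x ^ n \<le> exp (b * (real N * k))"
  proof -
    have "x ^ n \<le> x ^ N" using x n by (intro power_increasing)
    also have "\<dots> \<le> exp (b * k) ^ N"
      using x exp_ge_add_one_self[of "b * k"] by (intro power_mono) (auto simp: x_def)
    also have "\<dots> = exp (b * (real N * k))" by (simp add: exp_of_nat_mult[symmetric] algebra_simps)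
    finally show ?thesis .
  qed
  then have "b * \<eta> * x ^ n \<le> b * \<eta> * exp (b * (real N * k))" using b C by (intro mult_left_mono) auto
  finally show ?thesis by (simp add: b_def algebra_simps)
qed

section \<open>The second order error estimate\<close>

lemma le_add_mult_cINF:
  fixes F :: "'a \<Rightarrow> real"
  assumes "S \<noteq> {}" "C \<ge> 0" "\<And>v. v \<in> S \<Longrightarrow> e \<le> Q + C * F v"
  shows "e \<le> Q + C * (INF v\<in>S. F v)"
proof (cases "C = 0")
  case True
  then show ?thesis using assms by auto
next
  case False
  with assms have C: "C > 0" by simp
  have "(e - Q) / C \<le> (INF v\<in>S. F v)"
    using assms C by (intro cINF_greatest) (auto simp: pos_divide_le_eq algebra_simps)
  then show ?thesis using C by (simp add: pos_divide_le_eq algebra_simps)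
qed

theorem theorem23:
  fixes K D :: "'x::banach set"
    and \<gamma> :: "'x \<Rightarrow>\<^sub>L 'z::banach"
    and A :: "'x \<Rightarrow> 'x \<Rightarrow>\<^sub>L real"
    and \<phi> :: "'y::real_normed_vector \<Rightarrow> 'x \<Rightarrow> 'x \<Rightarrow> real"
    and j :: "'z \<Rightarrow> real"
    and jc :: "'z \<Rightarrow> 'z \<Rightarrow>\<^sub>L real"
    and f :: "real \<Rightarrow> 'x \<Rightarrow>\<^sub>L real"
    and R :: "'x \<Rightarrow>\<^sub>L 'y"
    and q :: "real \<times> real \<Rightarrow> 'x \<Rightarrow>\<^sub>L 'x"
    and a :: 'x
    and u :: "real \<Rightarrow> 'x"
    and H :: "real set"
    and Xh :: "real \<Rightarrow> 'x set"
    and c\<^sub>j L\<^sub>A m\<^sub>A \<alpha>\<^sub>\<phi> \<beta>\<^sub>\<phi> c0 c1 \<alpha>\<^sub>j \<alpha>\<^sub>c T :: real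
  assumes X_reflexive: "reflexive_space TYPE('x)"
    and K: "closed K" "convex K" "0 \<in> K"
    and \<gamma>_bound: "c\<^sub>j > 0" "\<And>v. norm (\<gamma> v) \<le> c\<^sub>j * norm v"
    and A_lipschitz: "L\<^sub>A > 0" "L\<^sub>A-lipschitz_on UNIV A"
    and A_monotone: "m\<^sub>A > 0"
      "\<And>v1 v2. (A v1 - A v2) (v1 - v2) \<ge> m\<^sub>A * (norm (v1 - v2))\<^sup>2"
    and D: "K \<subseteq> D"
    and \<phi>_convex_lsc: "\<And>y w. w \<in> D \<Longrightarrow> convex_on K (\<phi> y w) \<and> lsc_on K (\<phi> y w)"
    and \<phi>_bound: "\<alpha>\<^sub>\<phi> > 0" "\<beta>\<^sub>\<phi> > 0"
      "\<And>y1 y2 u1 u2 v1 v2. u1 \<in> D \<Longrightarrow> u2 \<in> D \<Longrightarrow> v1 \<in> K \<Longrightarrow> v2 \<in> K \<Longrightarrow>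
         \<phi> y1 u1 v2 - \<phi> y1 u1 v1 + \<phi> y2 u2 v1 - \<phi> y2 u2 v2
         \<le> \<alpha>\<^sub>\<phi> * norm (u1 - u2) * norm (v1 - v2) + \<beta>\<^sub>\<phi> * norm (y1 - y2) * norm (v1 - v2)"
    and j_lipschitz: "loc_lipschitz j"
    and j_growth: "c0 \<ge> 0" "c1 \<ge> 0"
      "\<And>z \<xi>. \<xi> \<in> clarke_subdiff j z \<Longrightarrow> norm \<xi> \<le> c0 + c1 * norm z"
    and j_relaxed: "\<alpha>\<^sub>j > 0"
      "\<And>z1 z2. clarke_deriv j z1 (z2 - z1) + clarke_deriv j z2 (z1 - z2) \<le> \<alpha>\<^sub>j * (norm (z1 - z2))\<^sup>2"
    and f: "continuous_on {0..} f"
    and jc: "linear jc" "\<alpha>\<^sub>c \<ge> 0" "\<And>z. norm (jc z) \<le> \<alpha>\<^sub>c * norm z"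
      "\<And>z. jc z z \<ge> \<alpha>\<^sub>j * (norm z)\<^sup>2"
    and small: "\<alpha>\<^sub>\<phi> + \<alpha>\<^sub>j * c\<^sub>j\<^sup>2 < m\<^sub>A" "\<alpha>\<^sub>\<phi> + \<alpha>\<^sub>c * c\<^sub>j\<^sup>2 < m\<^sub>A / 3"
    and q: "C2_on ({0..} \<times> {0..}) q"
    and u: "continuous_on {0..} u" "\<And>t. t \<ge> 0 \<Longrightarrow> u t \<in> K"
    and u_solution: "\<And>t v. t \<ge> 0 \<Longrightarrow> v \<in> K \<Longrightarrow>
        A (u t) (v - u t)
        + \<phi> (hist_op R q a u t) (u t) v - \<phi> (hist_op R q a u t) (u t) (u t)
        + clarke_deriv j (\<gamma> (u t)) (\<gamma> v - \<gamma> (u t))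
        \<ge> f t (v - u t)"
    and u_regular: "W2inf_loc u"
    and T: "T > 0"
    and H: "H \<subseteq> {0<..}"
    and Xh: "\<And>h. h \<in> H \<Longrightarrow> \<exists>B. finite B \<and> Xh h = span B"
  shows "\<exists>C6>0. \<forall>N\<ge>1. \<forall>h\<in>H. \<forall>ukh :: nat \<Rightarrow> 'x.
    (let k = T / real N; Kh = Xh h \<inter> K; t = (\<lambda>n::nat. real n * k);
         S = disc_hist_op R q a k ukh in
      (\<forall>n\<le>N. ukh n \<in> Kh) \<longrightarrow>
      (\<forall>n. 2 \<le> n \<and> n \<le> N \<longrightarrow> 2 *\<^sub>R ukh (n - 1) - ukh (n - 2) \<in> D) \<longrightarrow>
      (\<forall>n. 2 \<le> n \<and> n \<le> N \<longrightarrow> (\<forall>vh\<in>Kh.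
        A (ukh n) (vh - ukh n)
        + \<phi> (S n) (2 *\<^sub>R ukh (n - 1) - ukh (n - 2)) vh
        - \<phi> (S n) (2 *\<^sub>R ukh (n - 1) - ukh (n - 2)) (ukh n)
        + clarke_deriv j (\<gamma> (ukh n)) (\<gamma> vh - \<gamma> (ukh n))
        + jc (\<gamma> (ukh n)) (\<gamma> vh - \<gamma> (ukh n))
        \<ge> f (t n) (vh - ukh n)
        + jc (2 *\<^sub>R \<gamma> (ukh (n - 1)) - \<gamma> (ukh (n - 2))) (\<gamma> vh - \<gamma> (ukh n)))) \<longrightarrow>
      (\<forall>n. n \<le> 1 \<longrightarrow> (\<forall>vh\<in>Kh.
        A (ukh n) (vh - ukh n)
        + \<phi> (S n) (ukh n) vh - \<phi> (S n) (ukh n) (ukh n)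
        + clarke_deriv j (\<gamma> (ukh n)) (\<gamma> vh - \<gamma> (ukh n))
        \<ge> f (t n) (vh - ukh n))) \<longrightarrow>
      (MAX n\<in>{0..N}. norm (u (t n) - ukh n))
      \<le> C6 * (MAX n\<in>{0..N}. INF vh\<in>Kh.
                norm (u (t n) - vh) + sqrt (norm (\<gamma> (u (t n)) - \<gamma> vh))
                + sqrt \<bar>vhi_residual A \<phi> j \<gamma> (hist_op R q a u (t n)) (f (t n)) vh (u (t n))\<bar>)
        + C6 * k\<^sup>2)"
proof -
  obtain M where M: "M \<ge> 0" "discrete_W2inf T M u"
    using W2inf_loc_imp_discrete_W2inf[OF u(1) u_regular T] by blast
  obtain B where B: "B \<ge> 0" "\<And>t. t \<in> {0..T} \<Longrightarrow> discrete_W2inf T B (\<lambda>s. q (t, s))"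
    using C2_on_imp_discrete_W2inf[OF q, of T] by blast
  have growth: "\<bar>clarke_deriv j z x\<bar> \<le> (c0 + c1 * norm z) * norm x" for z x
    by (rule clarke_deriv_growth[OF j_lipschitz j_growth(3)])
  define G where "G = c\<^sub>j * M"
  have G: "norm (\<gamma> (u t)) \<le> G" if "t \<in> {0..T}" for t
  proof -
    have "norm (\<gamma> (u t)) \<le> c\<^sub>j * norm (u t)" by (rule \<gamma>_bound(2))
    also have "\<dots> \<le> G"
      unfolding G_def using discrete_W2infD(1)[OF M(2) that] \<gamma>_bound(1) by (intro mult_left_mono) auto
    finally show ?thesis .
  qed
  define c2 where "c2 = 2 * c0 + 2 * c1 * G"
  have c2: "c2 \<ge> 0" using j_growth \<gamma>_bound(1) M by (simp add: c2_def G_def)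

  define \<kappa> where "\<kappa> = \<alpha>\<^sub>\<phi> + \<alpha>\<^sub>c * c\<^sub>j\<^sup>2"
  have \<kappa>: "0 \<le> \<kappa>" "\<kappa> / m\<^sub>A < 1 / 3"
    using \<phi>_bound(1) jc(2) small(2) A_monotone(1) by (simp_all add: \<kappa>_def pos_divide_less_eq)
  \<comment> \<open>For the extrapolated steps: \<open>2 u(t - k) - u(t - 2 k)\<close> carries up to three times the largest earlier error, which is why the factor \<open>r + \<epsilon>\<close> must stay below \<open>1 / 3\<close>; the weight \<open>\<epsilon>\<close> uses up half of the gap.\<close>
  define r where "r = \<kappa> / m\<^sub>A"
  have r: "0 \<le> r" "r < 1 / 3" using \<kappa> A_monotone(1) by (simp_all add: r_def)
  define \<epsilon> where "\<epsilon> = (1 / 3 - r) / 2"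
  have \<epsilon>: "\<epsilon> > 0" using r by (simp add: \<epsilon>_def)
  define \<rho> where "\<rho> = 3 * (r + \<epsilon>)"
  have \<rho>: "0 \<le> \<rho>" "\<rho> < 1" using r by (simp_all add: \<rho>_def \<epsilon>_def field_simps)
  have \<rho>3: "\<kappa> / m\<^sub>A + \<epsilon> = \<rho> / 3" by (simp add: \<rho>_def r_def)
  have L1: "L\<^sub>A + c1 * c\<^sub>j\<^sup>2 + \<alpha>\<^sub>c * c\<^sub>j\<^sup>2 \<ge> 0" using A_lipschitz(1) j_growth jc(2) by simp
  obtain Ce where Ce: "Ce \<ge> 0" and explicit:
    "\<And>e X Y d d' E. 0 \<le> e \<Longrightarrow> 0 \<le> X \<Longrightarrow> 0 \<le> Y \<Longrightarrow> 0 \<le> d \<Longrightarrow> 0 \<le> d' \<Longrightarrow> 0 \<le> E \<Longrightarrow>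
      m\<^sub>A * e\<^sup>2 \<le> \<kappa> * X * (e + d) + \<beta>\<^sub>\<phi> * Y * (e + d)
        + (L\<^sub>A + c1 * c\<^sub>j\<^sup>2 + \<alpha>\<^sub>c * c\<^sub>j\<^sup>2) * e * d + c2 * d' + E \<Longrightarrow>
      e \<le> (\<kappa> / m\<^sub>A + \<epsilon>) * X + Ce * Y + Ce * (d + sqrt d' + sqrt E)"
    using error_from_energy_inequality[OF A_monotone(1) \<kappa>(1) less_imp_le[OF \<phi>_bound(2)] L1 c2 \<epsilon>] by blast
  \<comment> \<open>For the first two steps, which are implicit: here \<open>\<alpha>\<^sub>\<phi>\<close> and \<open>\<alpha>\<^sub>j\<close> are absorbed directly by the strong monotonicity, and there is no extrapolation error.\<close>
  define m1 where "m1 = m\<^sub>A - \<alpha>\<^sub>\<phi> - \<alpha>\<^sub>j * c\<^sub>j\<^sup>2"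
  have m1: "m1 > 0" using small(1) by (simp add: m1_def)
  have L2: "L\<^sub>A + \<alpha>\<^sub>\<phi> + c1 * c\<^sub>j\<^sup>2 \<ge> 0" using A_lipschitz(1) j_growth \<phi>_bound(1) by simp
  obtain Ci where Ci: "Ci \<ge> 0" and implicit:
    "\<And>e X Y d d' E. 0 \<le> e \<Longrightarrow> 0 \<le> X \<Longrightarrow> 0 \<le> Y \<Longrightarrow> 0 \<le> d \<Longrightarrow> 0 \<le> d' \<Longrightarrow> 0 \<le> E \<Longrightarrow>
      m1 * e\<^sup>2 \<le> 0 * X * (e + d) + \<beta>\<^sub>\<phi> * Y * (e + d) + (L\<^sub>A + \<alpha>\<^sub>\<phi> + c1 * c\<^sub>j\<^sup>2) * e * d + c2 * d' + E \<Longrightarrow>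
      e \<le> (0 / m1 + 1) * X + Ci * Y + Ci * (d + sqrt d' + sqrt E)"
    using error_from_energy_inequality[OF m1 order_refl less_imp_le[OF \<phi>_bound(2)] L2 c2 zero_less_one] by blast

  define Cs where "Cs = norm R * (4 * B * M * (T + 1) + 2 * B)"
  have Cs: "Cs \<ge> 0" using B M T by (simp add: Cs_def)
  define C0 where "C0 = M + (Ce + Ci) * (Cs + 1) + 1"
  have CC: "Ce * Cs \<ge> 0" "Ci * Cs \<ge> 0" using Ce Ci Cs by auto
  have C0: "C0 > 0" "M + Ce * Cs \<le> C0" "Ce * Cs \<le> C0" "Ce \<le> C0" "Ci * Cs \<le> C0" "Ci \<le> C0"
    using CC Ce Ci M unfolding C0_def by (simp_all add: algebra_simps)
  define C6 where "C6 = C0 / (1 - \<rho>) * exp (C0 / (1 - \<rho>) * T)"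
  have C6: "C6 > 0" using C0 \<rho> by (simp add: C6_def)
  have main: "(MAX n\<in>{0..N}. norm (u (real n * k) - w n))
      \<le> C6 * (MAX n\<in>{0..N}. INF vh\<in>Kh.
          norm (u (real n * k) - vh) + sqrt (norm (\<gamma> (u (real n * k)) - \<gamma> vh))
          + sqrt \<bar>vhi_residual A \<phi> j \<gamma> (hist_op R q a u (real n * k)) (f (real n * k)) vh (u (real n * k))\<bar>)
        + C6 * k\<^sup>2"
    if k: "k > 0" "real N * k = T" and Kh: "Kh \<subseteq> K" and w: "\<forall>n\<le>N. w n \<in> Kh"
      and wD: "\<forall>n. 2 \<le> n \<and> n \<le> N \<longrightarrow> 2 *\<^sub>R w (n - 1) - w (n - 2) \<in> D"
      and scheme: "\<forall>n. 2 \<le> n \<and> n \<le> N \<longrightarrow> (\<forall>vh\<in>Kh.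
        f (real n * k) (vh - w n) + jc (2 *\<^sub>R \<gamma> (w (n - 1)) - \<gamma> (w (n - 2))) (\<gamma> vh - \<gamma> (w n))
        \<le> A (w n) (vh - w n)
        + \<phi> (disc_hist_op R q a k w n) (2 *\<^sub>R w (n - 1) - w (n - 2)) vh
        - \<phi> (disc_hist_op R q a k w n) (2 *\<^sub>R w (n - 1) - w (n - 2)) (w n)
        + clarke_deriv j (\<gamma> (w n)) (\<gamma> vh - \<gamma> (w n))
        + jc (\<gamma> (w n)) (\<gamma> vh - \<gamma> (w n)))"
      and start: "\<forall>n\<le>1. \<forall>vh\<in>Kh.
        f (real n * k) (vh - w n) \<le> A (w n) (vh - w n)
        + \<phi> (disc_hist_op R q a k w n) (w n) vh - \<phi> (disc_hist_op R q a k w n) (w n) (w n)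
        + clarke_deriv j (\<gamma> (w n)) (\<gamma> vh - \<gamma> (w n))"
    for N :: nat and k :: real and Kh :: "'x set" and w :: "nat \<Rightarrow> 'x"
  proof -
    let ?S = "disc_hist_op R q a k w"
    let ?y = "\<lambda>n. hist_op R q a u (real n * k)"
    have t: "real n * k \<in> {0..T}" if "n \<le> N" for n
    proof -
      have "real n * k \<le> real N * k" using that k(1) by (intro mult_right_mono) auto
      then show ?thesis using k by simp
    qed
    have uK: "u (real n * k) \<in> K" for n using u(2) k(1) by simp
    have wK: "w n \<in> K" if "n \<le> N" for n using w that Kh by blast
    define e where "e = (\<lambda>n. norm (u (real n * k) - w n))"
    define Y where "Y = (\<lambda>n. norm (?y n - ?S n))"
    define res where "res = (\<lambda>n v. \<bar>vhi_residual A \<phi> j \<gamma> (?y n) (f (real n * k)) v (u (real n * k))\<bar>)"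
    define F where "F = (\<lambda>n v. norm (u (real n * k) - v) + sqrt (norm (\<gamma> (u (real n * k)) - \<gamma> v)) + sqrt (res n v))"
    define \<delta> where "\<delta> = (MAX n\<in>{0..N}. INF v\<in>Kh. F n v)"
    have ne: "Kh \<noteq> {}" using w by blast
    have F0: "F n v \<ge> 0" for n v by (simp add: F_def res_def)
    have \<delta>_ge: "(INF v\<in>Kh. F n v) \<le> \<delta>" if "n \<le> N" for n
      unfolding \<delta>_def using that by (intro Max_ge) auto
    have "0 \<le> (INF v\<in>Kh. F 0 v)" using ne F0 by (intro cINF_greatest) auto
    then have \<delta>0: "\<delta> \<ge> 0" using \<delta>_ge[of 0] by simp
    have Y_le: "Y n \<le> Cs * (k\<^sup>2 + k * (\<Sum>i<n. e i))" if n: "n \<le> N" for n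
    proof -
      let ?s = "k * (\<Sum>i<n. e i)"
      have s: "?s \<ge> 0" using k(1) by (intro mult_nonneg_nonneg sum_nonneg) (auto simp: e_def)
      have "Y n \<le> norm R * (4 * B * M * (T + 1) * k\<^sup>2 + 2 * B * ?s)"
        unfolding Y_def e_def using B(1) B(2)[OF t[OF n]] M T k(1) t[OF n]
        by (intro history_operator_error) auto
      also have "\<dots> \<le> norm R * ((4 * B * M * (T + 1) + 2 * B) * (k\<^sup>2 + ?s))"
      proof (rule mult_left_mono)
        have "0 \<le> 4 * B * M * (T + 1) * ?s" "0 \<le> 2 * B * k\<^sup>2" using B(1) M(1) T s by auto
        then show "4 * B * M * (T + 1) * k\<^sup>2 + 2 * B * ?s \<le> (4 * B * M * (T + 1) + 2 * B) * (k\<^sup>2 + ?s)"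
          unfolding distrib_left distrib_right by linarith
      qed simp
      finally show ?thesis by (simp only: Cs_def mult.assoc)
    qed

    have energy: "m\<^sub>A * (e n)\<^sup>2 \<le> \<alpha>\<^sub>\<phi> * norm (u (real n * k) - \<theta>) * (e n + norm (u (real n * k) - v))
        + \<beta>\<^sub>\<phi> * Y n * (e n + norm (u (real n * k) - v)) + L\<^sub>A * e n * norm (u (real n * k) - v)
        + (c2 + c1 * c\<^sub>j * e n) * norm (\<gamma> (u (real n * k)) - \<gamma> v) + res n v
        + \<alpha>\<^sub>j * (norm (\<gamma> (u (real n * k)) - \<gamma> (w n)))\<^sup>2 + J"
      if n: "n \<le> N" and v: "v \<in> Kh" and \<theta>: "\<theta> \<in> D"
        and disc: "A (w n) (v - w n) + \<phi> (?S n) \<theta> v - \<phi> (?S n) \<theta> (w n)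
          + clarke_deriv j (\<gamma> (w n)) (\<gamma> v - \<gamma> (w n)) + J \<ge> f (real n * k) (v - w n)"
      for n v \<theta> J
      unfolding e_def Y_def c2_def res_def
    proof (rule vhi_energy_inequality)
      let ?u = "u (real n * k)"
      show "m\<^sub>A * (norm (?u - w n))\<^sup>2 \<le> (A ?u - A (w n)) (?u - w n)" by (rule A_monotone(2))
      show "norm (A ?u - A (w n)) \<le> L\<^sub>A * norm (?u - w n)"
        using lipschitz_onD[OF A_lipschitz(2), of ?u "w n"] by (simp add: dist_norm)
      show "\<phi> (?y n) ?u (w n) - \<phi> (?y n) ?u v + \<phi> (?S n) \<theta> v - \<phi> (?S n) \<theta> (w n)
        \<le> \<alpha>\<^sub>\<phi> * norm (?u - \<theta>) * norm (v - w n) + \<beta>\<^sub>\<phi> * norm (?y n - ?S n) * norm (v - w n)"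
        by (rule \<phi>_bound(3)[OF subsetD[OF D uK] \<theta> subsetD[OF Kh v] wK[OF n]])
      show "f (real n * k) (w n - ?u) \<le> A ?u (w n - ?u) + \<phi> (?y n) ?u (w n) - \<phi> (?y n) ?u ?u
          + clarke_deriv j (\<gamma> ?u) (\<gamma> (w n) - \<gamma> ?u)"
        using u_solution[OF _ wK[OF n]] k(1) by simp
      show "norm (\<gamma> ?u) \<le> G" by (rule G[OF t[OF n]])
    qed (use \<phi>_bound(1,2) j_growth(2) in \<open>auto intro: \<gamma>_bound j_lipschitz growth j_relaxed disc\<close>)

    have step: "e n \<le> \<rho> * P + C0 * (\<delta> + k\<^sup>2) + C0 * (k * (\<Sum>i<n. e i))"
      if n: "n \<le> N" and P: "0 \<le> P" "\<And>i. i < n \<Longrightarrow> e i \<le> P" for n P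
    proof -
      let ?u = "u (real n * k)"
      let ?s = "k * (\<Sum>i<n. e i)"
      have s: "?s \<ge> 0" using k(1) by (intro mult_nonneg_nonneg sum_nonneg) (auto simp: e_def)
      have en: "e n \<ge> 0" "Y n \<ge> 0" by (simp_all add: e_def Y_def)
      have trace: "c1 * c\<^sub>j * e n * norm (\<gamma> ?u - \<gamma> v) \<le> c1 * c\<^sub>j\<^sup>2 * e n * norm (?u - v)" for v
      proof -
        have "c1 * c\<^sub>j * e n * norm (\<gamma> (?u - v)) \<le> c1 * c\<^sub>j * e n * (c\<^sub>j * norm (?u - v))"
          using j_growth(2) \<gamma>_bound en by (intro mult_left_mono) auto
        then show ?thesis by (simp add: blinfun.diff_right power2_eq_square ac_simps)
      qed
      have combine: "e n \<le> \<rho> * P + C0 * (\<delta> + k\<^sup>2) + C0 * ?s"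
        if le: "e n \<le> \<rho> * P + M * k\<^sup>2 + C * Y n + C * (INF v\<in>Kh. F n v)"
          and C: "0 \<le> C" "M + C * Cs \<le> C0" "C * Cs \<le> C0" "C \<le> C0" for C
      proof -
        have "C * Y n \<le> C * (Cs * (k\<^sup>2 + ?s))" using Y_le[OF n] C(1) by (rule mult_left_mono)
        moreover have "C * (INF v\<in>Kh. F n v) \<le> C * \<delta>" using \<delta>_ge[OF n] C(1) by (rule mult_left_mono)
        moreover have "C * \<delta> \<le> C0 * \<delta>" using C(4) \<delta>0 by (rule mult_right_mono)
        moreover have "(M + C * Cs) * k\<^sup>2 \<le> C0 * k\<^sup>2" using C(2) by (rule mult_right_mono) simp
        moreover have "C * Cs * ?s \<le> C0 * ?s" using C(3) s by (rule mult_right_mono)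
        moreover have "C * (Cs * (k\<^sup>2 + ?s)) = C * Cs * k\<^sup>2 + C * Cs * ?s"
          "(M + C * Cs) * k\<^sup>2 = M * k\<^sup>2 + C * Cs * k\<^sup>2" "C0 * (\<delta> + k\<^sup>2) = C0 * \<delta> + C0 * k\<^sup>2"
          by (simp_all only: distrib_left distrib_right mult.assoc)
        ultimately show ?thesis using le by linarith
      qed
      show ?thesis
      proof (cases "n \<le> 1")
        case True
        have "e n \<le> Ci * Y n + Ci * F n v" if v: "v \<in> Kh" for v
        proof -
          let ?d = "norm (?u - v)" and ?d' = "norm (\<gamma> ?u - \<gamma> v)"
          have "m\<^sub>A * (e n)\<^sup>2 \<le> \<alpha>\<^sub>\<phi> * e n * (e n + ?d) + \<beta>\<^sub>\<phi> * Y n * (e n + ?d) + L\<^sub>A * e n * ?d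
            + (c2 + c1 * c\<^sub>j * e n) * ?d' + res n v + \<alpha>\<^sub>j * (norm (\<gamma> ?u - \<gamma> (w n)))\<^sup>2 + 0"
            using energy[OF n v, of "w n" 0] start True v D wK[OF n] by (auto simp: e_def)
          moreover have "\<alpha>\<^sub>j * (norm (\<gamma> ?u - \<gamma> (w n)))\<^sup>2 \<le> \<alpha>\<^sub>j * (c\<^sub>j * e n)\<^sup>2"
            using \<gamma>_bound(2)[of "?u - w n"] j_relaxed(1)
            by (intro mult_left_mono power_mono) (auto simp: blinfun.diff_right e_def)
          ultimately have "m1 * (e n)\<^sup>2 \<le> 0 * 0 * (e n + ?d) + \<beta>\<^sub>\<phi> * Y n * (e n + ?d)
              + (L\<^sub>A + \<alpha>\<^sub>\<phi> + c1 * c\<^sub>j\<^sup>2) * e n * ?d + c2 * ?d' + res n v"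
            using trace[of v] by (simp add: m1_def algebra_simps power2_eq_square)
          from implicit[OF en(1) order_refl en(2) norm_ge_zero norm_ge_zero _ this]
          show ?thesis by (simp add: F_def res_def)
        qed
        then have "e n \<le> Ci * Y n + Ci * (INF v\<in>Kh. F n v)"
          using ne Ci by (intro le_add_mult_cINF) auto
        moreover have "0 \<le> \<rho> * P" "0 \<le> M * k\<^sup>2" using \<rho> P M by auto
        ultimately have "e n \<le> \<rho> * P + M * k\<^sup>2 + Ci * Y n + Ci * (INF v\<in>Kh. F n v)" by linarith
        then show ?thesis
          by (rule combine) (use Ci CC Ce M C0 in \<open>simp_all add: C0_def algebra_simps\<close>)
      next
        case False
        then have n2: "2 \<le> n" by simp
        let ?\<theta> = "2 *\<^sub>R w (n - 1) - w (n - 2)"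
        define X where "X = norm (?u - ?\<theta>)"
        have X: "X \<le> 3 * P + M * k\<^sup>2"
        proof -
          let ?u1 = "u (real (n - 1) * k)" and ?u2 = "u (real (n - 2) * k)"
          \<comment> \<open>Three consecutive time levels form a second difference of \<open>u\<close>, of order \<open>k\<^sup>2\<close>; the rest are earlier errors with weights 2 and 1.\<close>
          have eq: "real (n - 1) * k + k = real n * k" "real (n - 1) * k - k = real (n - 2) * k"
            using n2 by (simp_all add: of_nat_diff algebra_simps add_divide_distrib diff_divide_distrib)
          have "norm (u (real (n - 1) * k + k) - 2 *\<^sub>R ?u1 + u (real (n - 1) * k - k)) \<le> M * k\<^sup>2"
          proof (rule discrete_W2infD(3)[OF M(2)])
            show "0 \<le> k" using k(1) by simp
            show "0 \<le> real (n - 1) * k - k" unfolding eq using k(1) by simp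
            show "real (n - 1) * k + k \<le> T" unfolding eq using t[OF n] by simp
          qed
          then have sd: "norm (?u - 2 *\<^sub>R ?u1 + ?u2) \<le> M * k\<^sup>2" unfolding eq .
          have "?u - ?\<theta> = (?u - 2 *\<^sub>R ?u1 + ?u2) + (2 *\<^sub>R (?u1 - w (n - 1)) - (?u2 - w (n - 2)))"
            by (simp add: scaleR_diff_right)
          also have "norm \<dots> \<le> M * k\<^sup>2 + (2 * P + P)"
          proof (rule norm_triangle_mono[OF sd norm_triangle_le_diff[OF add_mono]])
            show "norm (2 *\<^sub>R (?u1 - w (n - 1))) \<le> 2 * P" using P(2)[of "n - 1"] n2 by (simp add: e_def)
            show "norm (?u2 - w (n - 2)) \<le> P" using P(2)[of "n - 2"] n2 by (simp add: e_def)
          qed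
          finally show ?thesis by (simp add: X_def)
        qed
        have "e n \<le> \<rho> / 3 * X + Ce * Y n + Ce * F n v" if v: "v \<in> Kh" for v
        proof -
          let ?d = "norm (?u - v)" and ?d' = "norm (\<gamma> ?u - \<gamma> v)"
          let ?J = "jc (\<gamma> (w n)) (\<gamma> v - \<gamma> (w n)) - jc (\<gamma> ?\<theta>) (\<gamma> v - \<gamma> (w n))"
          have \<gamma>\<theta>: "\<gamma> ?\<theta> = 2 *\<^sub>R \<gamma> (w (n - 1)) - \<gamma> (w (n - 2))" by (simp add: blinfun.bilinear_simps)
          have "m\<^sub>A * (e n)\<^sup>2 \<le> \<alpha>\<^sub>\<phi> * X * (e n + ?d) + \<beta>\<^sub>\<phi> * Y n * (e n + ?d) + L\<^sub>A * e n * ?d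
            + (c2 + c1 * c\<^sub>j * e n) * ?d' + res n v + \<alpha>\<^sub>j * (norm (\<gamma> ?u - \<gamma> (w n)))\<^sup>2 + ?J"
            unfolding X_def
          proof (rule energy[OF n v])
            show "?\<theta> \<in> D" using wD n2 n by blast
            show "f (real n * k) (v - w n) \<le> A (w n) (v - w n) + \<phi> (?S n) ?\<theta> v - \<phi> (?S n) ?\<theta> (w n)
              + clarke_deriv j (\<gamma> (w n)) (\<gamma> v - \<gamma> (w n)) + ?J"
              using scheme[rule_format, of n v] n2 n v unfolding \<gamma>\<theta> by auto
          qed
          moreover have "?J + \<alpha>\<^sub>j * (norm (\<gamma> ?u - \<gamma> (w n)))\<^sup>2 \<le> \<alpha>\<^sub>c * c\<^sub>j\<^sup>2 * (X * (e n + ?d) + e n * ?d)"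
            unfolding X_def e_def
            using \<gamma>_bound by (intro extrapolated_stabilization_bound jc) auto
          ultimately have "m\<^sub>A * (e n)\<^sup>2 \<le> \<kappa> * X * (e n + ?d) + \<beta>\<^sub>\<phi> * Y n * (e n + ?d)
              + (L\<^sub>A + c1 * c\<^sub>j\<^sup>2 + \<alpha>\<^sub>c * c\<^sub>j\<^sup>2) * e n * ?d + c2 * ?d' + res n v"
            using trace[of v] by (simp add: \<kappa>_def algebra_simps)
          from explicit[OF en(1) _ en(2) norm_ge_zero norm_ge_zero _ this]
          show ?thesis by (simp add: F_def res_def X_def \<rho>3)
        qed
        then have "e n \<le> (\<rho> / 3 * X + Ce * Y n) + Ce * (INF v\<in>Kh. F n v)"
          using ne Ce by (intro le_add_mult_cINF) auto
        moreover have "\<rho> / 3 * X \<le> \<rho> * P + M * k\<^sup>2"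
        proof -
          have "\<rho> / 3 * X \<le> \<rho> / 3 * (3 * P + M * k\<^sup>2)" using X \<rho> by (intro mult_left_mono) auto
          also have "\<dots> = \<rho> * P + \<rho> / 3 * (M * k\<^sup>2)" by (simp add: algebra_simps)
          also have "\<rho> / 3 * (M * k\<^sup>2) \<le> 1 * (M * k\<^sup>2)" using \<rho> M by (intro mult_right_mono) auto
          finally show ?thesis by simp
        qed
        ultimately have "e n \<le> \<rho> * P + M * k\<^sup>2 + Ce * Y n + Ce * (INF v\<in>Kh. F n v)" by linarith
        then show ?thesis by (rule combine) (use Ce C0 in simp_all)
      qed
    qed

    have "e n \<le> C6 * \<delta> + C6 * k\<^sup>2" if n: "n \<le> N" for n
    proof -
      have "e n \<le> C0 / (1 - \<rho>) * exp (C0 / (1 - \<rho>) * (real N * k)) * (\<delta> + k\<^sup>2)"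
        using \<rho> C0(1) k(1) \<delta>0
        by (intro discrete_gronwall_contraction[OF \<rho>(1,2) _ k(1) _ step n]) auto
      then show ?thesis unfolding k(2) C6_def[symmetric] by (simp add: distrib_left)
    qed
    then show "(MAX n\<in>{0..N}. norm (u (real n * k) - w n))
      \<le> C6 * (MAX n\<in>{0..N}. INF vh\<in>Kh.
          norm (u (real n * k) - vh) + sqrt (norm (\<gamma> (u (real n * k)) - \<gamma> vh))
          + sqrt \<bar>vhi_residual A \<phi> j \<gamma> (?y n) (f (real n * k)) vh (u (real n * k))\<bar>)
        + C6 * k\<^sup>2"
      unfolding e_def \<delta>_def F_def res_def by (subst Max_le_iff) auto
  qed
  show ?thesis
    unfolding Let_def
  proof (intro exI[of _ C6] conjI allI ballI impI C6, rule main)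
    fix N :: nat assume "1 \<le> N"
    then show "T / real N > 0" "real N * (T / real N) = T" using T by simp_all
  qed auto
qed

end
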